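(* Suppose $r, t$ are positive integers and $k = \mathrm{kc}_r(t) < \infty$. Then there exist constants $C, c > 0$ such that for $G \sim \mathcal{G}(n,p)$: (a) if $p < c\left(\frac{\log n}{n}\right)^{1/k}$, then w.h.p. $\mathrm{tc}_r(G) > t$; and (b) if $p > C\left(\frac{\log n}{n}\right)^{1/(k+1)}$, then w.h.p. $\mathrm{tc}_r(G) \le t$.
   Context: For a graph $G$ and positive integer $r$, $\mathrm{tc}_r(G)$ is the minimum $m$ such that for every $r$-colouring of $E(G)$ there are $m$ monochromatic connected components (single vertices count as components in each colour) covering $V(G)$. An $r$-graph $H$ is $r$-partite if $V(H) = V_1 \sqcup \dots \sqcup V_r$ with $|e \cap V_i| = 1$ for every edge $e$ and every $i$. A cover of a set of edges is a set of vertices meeting each of them; $\tau(H)$ is the minimum size of a cover of $E(H)$. An $r$-partite $r$-graph $H$ has intersecting $k$-covers if there is a function $\phi: E(H)^k \to E(H)$ such that for every $k$-tuple $T$ of edges, $\phi(T)$ intersects every edge of $T$, and $\phi(T) \cap \phi(T') \ne \emptyset$ for all $k$-tuples $T, T'$. For positive integers $r,t$, $\mathrm{kc}_r(t)$ is the minimum $k$ such that every $r$-partite $r$-graph with intersecting $k$-covers has $\tau(H) \le t$. $\mathcal{G}(n,p)$ is the binomial random graph; w.h.p. means with probability tending to $1$ as $n\to\infty$. *)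

theory Defs
  imports "HOL-Probability.Probability" "HOL-Library.Extended_Nat"
begin

text \<open>
  Graphs and hypergraphs are given by a vertex set and a set of edges, each edge being a set of
  vertices; hypergraphs are finite.
\<close>

definition uniform_hypergraph :: "nat \<Rightarrow> 'a set \<Rightarrow> 'a set set \<Rightarrow> bool" where
  "uniform_hypergraph r V E \<longleftrightarrow> finite V \<and> (\<forall>e\<in>E. e \<subseteq> V \<and> card e = r)"

definition partite_hypergraph :: "nat \<Rightarrow> 'a set \<Rightarrow> 'a set set \<Rightarrow> bool" where
  "partite_hypergraph r V E \<longleftrightarrow>
     uniform_hypergraph r V E \<and>
     (\<exists>P :: nat \<Rightarrow> 'a set.
        disjoint_family_on P {..<r} \<and> V = (\<Union>i<r. P i) \<and>
        (\<forall>e\<in>E. \<forall>i<r. card (e \<inter> P i) = 1))"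

definition edge_cover :: "'a set \<Rightarrow> 'a set set \<Rightarrow> bool" where
  "edge_cover S E \<longleftrightarrow> (\<forall>e\<in>E. S \<inter> e \<noteq> {})"

definition cover_number :: "'a set \<Rightarrow> 'a set set \<Rightarrow> nat" where
  "cover_number V E = (LEAST m. \<exists>S. S \<subseteq> V \<and> finite S \<and> edge_cover S E \<and> card S = m)"

text \<open>\<open>k\<close>-tuples of edges are lists of length \<open>k\<close>; repeated entries are allowed.\<close>

definition edge_tuples :: "nat \<Rightarrow> 'a set set \<Rightarrow> 'a set list set" where
  "edge_tuples k E = {T. length T = k \<and> set T \<subseteq> E}"

definition intersecting_covers :: "nat \<Rightarrow> 'a set set \<Rightarrow> bool" where
  "intersecting_covers k E \<longleftrightarrow>
     (\<exists>\<phi>. \<phi> \<in> edge_tuples k E \<rightarrow> E \<and>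
        (\<forall>T\<in>edge_tuples k E. \<forall>e\<in>set T. \<phi> T \<inter> e \<noteq> {}) \<and>
        (\<forall>T\<in>edge_tuples k E. \<forall>T'\<in>edge_tuples k E. \<phi> T \<inter> \<phi> T' \<noteq> {}))"

text \<open>
  Every finite hypergraph is isomorphic to one with vertices in \<^typ>\<open>nat\<close>, so quantifying over
  those covers all hypergraphs. The infimum of the empty set is \<open>\<infinity>\<close>.
\<close>

definition kc :: "nat \<Rightarrow> nat \<Rightarrow> enat" where
  "kc r t = Inf {enat k | k. k > 0 \<and>
     (\<forall>(V :: nat set) E. partite_hypergraph r V E \<longrightarrow> intersecting_covers k E \<longrightarrow>
        cover_number V E \<le> t)}"

definition graph_components :: "'a set \<Rightarrow> 'a set set \<Rightarrow> 'a set set" where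
  "graph_components V E = (\<lambda>v. {u \<in> V. (v, u) \<in> {(x, y). {x, y} \<in> E}\<^sup>*}) ` V"

text \<open>
  Each colour class is taken on the whole vertex set, so a vertex meeting no edge of colour \<open>i\<close>
  is a component of colour \<open>i\<close>.
\<close>

definition mono_components :: "nat \<Rightarrow> 'a set \<Rightarrow> 'a set set \<Rightarrow> ('a set \<Rightarrow> nat) \<Rightarrow> 'a set set" where
  "mono_components r V E f = (\<Union>i<r. graph_components V {e \<in> E. f e = i})"

text \<open>
  The covering components need not be distinct, hence \<open>card \<C> \<le> m\<close> rather than equality.
\<close>

definition tc :: "nat \<Rightarrow> 'a set \<Rightarrow> 'a set set \<Rightarrow> nat" where
  "tc r V E = (LEAST m. \<forall>f \<in> E \<rightarrow> {..<r}.
     \<exists>\<C>. \<C> \<subseteq> mono_components r V E f \<and> finite \<C> \<and> card \<C> \<le> m \<and> V \<subseteq> \<Union>\<C>)"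

definition vertex_pairs :: "nat \<Rightarrow> nat set set" where
  "vertex_pairs n = {e. e \<subseteq> {..<n} \<and> card e = 2}"

text \<open>The distribution of the edge set of \<open>\<G>(n,p)\<close> on the vertex set \<open>{..<n}\<close>.\<close>

definition random_graph :: "nat \<Rightarrow> real \<Rightarrow> nat set set pmf" where
  "random_graph n p =
     map_pmf (\<lambda>f. {e \<in> vertex_pairs n. f e})
       (Pi_pmf (vertex_pairs n) False (\<lambda>_. bernoulli_pmf p))"

text \<open>\<open>Q n E\<close> is a property of the graph with vertex set \<open>{..<n}\<close> and edge set \<open>E\<close>.\<close>

definition whp :: "(nat \<Rightarrow> real) \<Rightarrow> (nat \<Rightarrow> nat set set \<Rightarrow> bool) \<Rightarrow> bool" where
  "whp p Q \<longleftrightarrow>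
     (\<lambda>n. measure_pmf.prob (random_graph n (p n)) {E. Q n E}) \<longlonglongrightarrow> 1"

end

theory Submission
  imports Defs "HOL-Real_Asymp.Real_Asymp"
begin

text \<open>
  An \<open>r\<close>-coloured graph determines an \<open>r\<close>-partite component hypergraph: its vertices are the
  monochromatic components, and each graph vertex \<open>v\<close> gives the hyperedge of the \<open>r\<close> components
  containing \<open>v\<close>. Adjacent vertices give intersecting hyperedges, and covers of the hyperedges are
  covers of the graph by components.

  (b) In the dense range any \<open>k\<close> vertices have at least \<open>m = n p\<^sup>k / 8\<close> common neighbours, and any two
  disjoint sets of size proportional to \<open>m\<close> are joined by an edge. For a tuple \<open>T\<close> of hyperedges
  pass to a subset of a positive proportion of the common neighbours on which some colours have a
  single component while every component of the remaining colours is small. For two tuples the fixed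
  components must agree in some colour: otherwise the two subsets could be shrunk, colour by colour, to
  sets that are still large but share no component, hence are not joined by an edge. So any
  vertex of the subset can serve as \<open>\<phi> T\<close>, the component hypergraph has intersecting \<open>k\<close>-covers,
  and the definition of \<open>kc\<close> applies.

  (a) Take a hypergraph \<open>H\<close> with intersecting \<open>(k - 1)\<close>-covers and cover number above \<open>t\<close>
  (\<open>t + 1\<close> disjoint edges if \<open>k = 1\<close>), and reserve about \<open>n\<^sup>\<delta>\<close> disjoint blocks of
  \<open>card H\<close> vertices. In the sparse range there are no edges inside the union of the blocks, and
  for some block no outside vertex has \<open>k\<close> neighbours in it. Label this block by the hyperedges,
  and every other vertex by the cover of the labels of its neighbours in the block; adjacent vertices then have
  intersecting labels, which yields a colouring as expensive to cover as \<open>H\<close>.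
\<close>

section \<open>Sets with few and small components\<close>

text \<open>Among the sets \<open>X\<close> whose fibres hold at most three quarters of
  \<open>A\<close>, take one of largest weight. Were its weight below one quarter, a further fibre,
  having at most half of \<open>A\<close>, could be added without passing three quarters.\<close>

lemma exists_balanced_union_of_fibres:
  fixes c :: "'a \<Rightarrow> 'b"
  assumes A: "finite A" and small: "\<And>y. 2 * card {a \<in> A. c a = y} \<le> card A"
  shows "\<exists>X. card A \<le> 4 * card {a \<in> A. c a \<in> X} \<and> card A \<le> 4 * card {a \<in> A. c a \<notin> X}"
proof -
  define w where "w X = card {a \<in> A. c a \<in> X}" for X
  have compl: "card {a \<in> A. c a \<notin> X} = card A - w X" for X
  proof -
    have "{a \<in> A. c a \<notin> X} = A - {a \<in> A. c a \<in> X}" by auto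
    then show ?thesis unfolding w_def using A by (simp add: card_Diff_subset)
  qed
  have wle: "w X \<le> card A" for X unfolding w_def using A by (intro card_mono) auto
  let ?F = "{X. X \<subseteq> c ` A \<and> 4 * w X \<le> 3 * card A}"
  have "{} \<in> ?F" by (simp add: w_def)
  then have "\<exists>X. X \<in> ?F \<and> (\<forall>Y. Y \<in> ?F \<longrightarrow> w Y \<le> w X)"
    using wle by (intro ex_has_greatest_nat[where k = "{}" and b = "Suc (card A)"])
      (auto simp: less_Suc_eq_le)
  then obtain X where X: "X \<in> ?F" and max: "\<And>Y. Y \<in> ?F \<Longrightarrow> w Y \<le> w X" by blast
  have "card A \<le> 4 * w X"
  proof (rule ccontr)
    assume less: "\<not> card A \<le> 4 * w X"
    have "X \<noteq> c ` A"
    proof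
      assume "X = c ` A"
      then have "{a \<in> A. c a \<in> X} = A" by auto
      then show False using less by (simp add: w_def)
    qed
    then obtain a where a: "a \<in> A" "c a \<notin> X" using X by auto
    have "{b \<in> A. c b \<in> insert (c a) X} = {b \<in> A. c b \<in> X} \<union> {b \<in> A. c b = c a}" by auto
    then have w: "w (insert (c a) X) = w X + card {b \<in> A. c b = c a}"
      unfolding w_def using A a by (subst card_Un_disjoint[symmetric]) auto
    have pos: "card {b \<in> A. c b = c a} > 0" using A a by (auto simp: card_gt_0_iff)
    have "insert (c a) X \<in> ?F" using X a w small[of "c a"] less by auto
    from max[OF this] show False using w pos by simp
  qed
  moreover have "card A \<le> 4 * (card A - w X)" using X by auto
  ultimately show ?thesis using compl[of X] unfolding w_def[symmetric] by (intro exI[of _ X]) simp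
qed

text \<open>\<open>B\<close> keeps its part inside or outside a balanced union of fibres of
  \<open>A\<close>, whichever is large enough, and \<open>A\<close> keeps the opposite part. Only
  one of the two sets has to have small fibres.\<close>

lemma separate_one_colour:
  fixes c :: "'a \<Rightarrow> 'b"
  assumes "finite A" "finite B" and "\<And>y. 2 * card {a \<in> A. c a = y} \<le> card A"
  shows "\<exists>A' B'. A' \<subseteq> A \<and> B' \<subseteq> B \<and> c ` A' \<inter> c ` B' = {} \<and>
    card A \<le> 4 * card A' \<and> card B \<le> 4 * card B'"
proof -
  obtain X where X: "card A \<le> 4 * card {a \<in> A. c a \<in> X}" "card A \<le> 4 * card {a \<in> A. c a \<notin> X}"
    using exists_balanced_union_of_fibres[of A c, OF assms(1,3)] by blast
  let ?B1 = "{b \<in> B. c b \<in> X}" and ?B2 = "{b \<in> B. c b \<notin> X}"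
  have "B = ?B1 \<union> ?B2" by auto
  then have "card B \<le> card ?B1 + card ?B2" by (metis card_Un_le)
  then consider "card B \<le> 4 * card ?B1" | "card B \<le> 4 * card ?B2" by linarith
  then show ?thesis
  proof cases
    case 1
    then show ?thesis using X
      by (intro exI[of _ "{a \<in> A. c a \<notin> X}"] exI[of _ ?B1]) auto
  next
    case 2
    then show ?thesis using X
      by (intro exI[of _ "{a \<in> A. c a \<in> X}"] exI[of _ ?B2]) auto
  qed
qed

definition spread :: "nat \<Rightarrow> ('a \<Rightarrow> 'b) \<Rightarrow> 'a set \<Rightarrow> bool" where
  "spread N c A \<longleftrightarrow> (\<forall>y. N * card {a \<in> A. c a = y} \<le> card A)"

lemma spread_subset:
  assumes "spread (N * L) c A" "finite A" "A' \<subseteq> A" "card A \<le> L * card A'" "L > 0"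
  shows "spread N c A'"
  unfolding spread_def
proof
  fix y
  have "card {a \<in> A'. c a = y} \<le> card {a \<in> A. c a = y}"
    using assms by (intro card_mono) auto
  then have "N * L * card {a \<in> A'. c a = y} \<le> N * L * card {a \<in> A. c a = y}" by simp
  also have "\<dots> \<le> L * card A'" using assms unfolding spread_def by (meson order_trans)
  finally have "L * (N * card {a \<in> A'. c a = y}) \<le> L * card A'" by (simp add: ac_simps)
  then show "N * card {a \<in> A'. c a = y} \<le> card A'" using assms by simp
qed

lemma spread_antimono: "spread N c A \<Longrightarrow> N' \<le> N \<Longrightarrow> spread N' c A"
  unfolding spread_def
proof (intro allI)
  fix y
  assume *: "\<forall>y. N * card {a \<in> A. c a = y} \<le> card A" and "N' \<le> N"
  then have "N' * card {a \<in> A. c a = y} \<le> N * card {a \<in> A. c a = y}" by simp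
  also have "\<dots> \<le> card A" using * by simp
  finally show "N' * card {a \<in> A. c a = y} \<le> card A" .
qed

text \<open>Colours are separated one at a time. Each round costs a factor of at most 4 in both
  sets, so within \<open>r\<close> rounds a colour that was spread with constant
  \<open>2 * 4 ^ r\<close> remains spread with constant 2, as \<open>separate_one_colour\<close>
  requires.\<close>

lemma separate_colours:
  fixes c :: "'i \<Rightarrow> 'a \<Rightarrow> 'b"
  assumes "finite D" "finite A" "finite B" "card D \<le> r"
    and "\<And>i. i \<in> D \<Longrightarrow> spread (2 * 4 ^ r) (c i) A \<or> spread (2 * 4 ^ r) (c i) B"
  shows "\<exists>A' B'. A' \<subseteq> A \<and> B' \<subseteq> B \<and> (\<forall>i\<in>D. c i ` A' \<inter> c i ` B' = {}) \<and>
    card A \<le> 4 ^ card D * card A' \<and> card B \<le> 4 ^ card D * card B'"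
  using assms
proof (induction D rule: finite_induct)
  case empty
  then show ?case by auto
next
  case (insert i D)
  then obtain A' B' where AB: "A' \<subseteq> A" "B' \<subseteq> B" "\<forall>i\<in>D. c i ` A' \<inter> c i ` B' = {}"
    "card A \<le> 4 ^ card D * card A'" "card B \<le> 4 ^ card D * card B'" by auto
  have fin: "finite A'" "finite B'" using AB insert.prems by (auto intro: finite_subset)
  have le: "(2::nat) * 4 ^ card D \<le> 2 * 4 ^ r" using insert by simp
  have "spread 2 (c i) A' \<or> spread 2 (c i) B'"
    using insert.prems(4)[of i] AB insert.prems
      spread_subset[of 2 "4 ^ card D" "c i" A A'] spread_subset[of 2 "4 ^ card D" "c i" B B']
      spread_antimono[OF _ le, of "c i" A] spread_antimono[OF _ le, of "c i" B]
    by (metis insertI1 zero_less_numeral zero_less_power)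
  then have "\<exists>A'' B''. A'' \<subseteq> A' \<and> B'' \<subseteq> B' \<and> c i ` A'' \<inter> c i ` B'' = {} \<and>
      card A' \<le> 4 * card A'' \<and> card B' \<le> 4 * card B''"
  proof
    assume "spread 2 (c i) A'"
    then show ?thesis
      unfolding spread_def using separate_one_colour[of A' B' "c i"] fin by blast
  next
    assume "spread 2 (c i) B'"
    then obtain B'' A'' where "B'' \<subseteq> B'" "A'' \<subseteq> A'" "c i ` B'' \<inter> c i ` A'' = {}"
      "card B' \<le> 4 * card B''" "card A' \<le> 4 * card A''"
      unfolding spread_def using separate_one_colour[of B' A' "c i"] fin by blast
    then show ?thesis by (intro exI[of _ A''] exI[of _ B'']) (simp add: Int_commute)
  qed
  then obtain A'' B'' where AB2: "A'' \<subseteq> A'" "B'' \<subseteq> B'" "c i ` A'' \<inter> c i ` B'' = {}"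
      "card A' \<le> 4 * card A''" "card B' \<le> 4 * card B''" by blast
  have "card A \<le> 4 ^ card D * (4 * card A'')" "card B \<le> 4 ^ card D * (4 * card B'')"
    using AB AB2 by (meson mult_le_mono2 order_trans)+
  moreover have "\<forall>j\<in>insert i D. c j ` A'' \<inter> c j ` B'' = {}" using AB AB2 by blast
  ultimately show ?case using AB AB2 insert.hyps
    by (intro exI[of _ A''] exI[of _ B'']) (auto simp: ac_simps)
qed

text \<open>If some colour has a fibre with more than a proportion 1/\<open>N\<close> of
  \<open>A\<close>, restrict to that fibre and repeat with the remaining colours. A colour once
  constant stays constant on subsets, and spreadness is read off only when no heavy fibre remains.
  There are at most \<open>card I\<close> restrictions, each costing a factor
  \<open>N\<close>.\<close>

lemma ex_concentrated_subset:
  fixes c :: "'i \<Rightarrow> 'a \<Rightarrow> 'b"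
  assumes "finite I" "finite A" "N > 0"
  shows "\<exists>A' J. A' \<subseteq> A \<and> J \<subseteq> I \<and> card A \<le> N ^ card I * card A' \<and>
    (\<forall>i\<in>J. \<forall>x\<in>A'. \<forall>y\<in>A'. c i x = c i y) \<and> (\<forall>i\<in>I - J. spread N (c i) A')"
  using assms
proof (induction "card I" arbitrary: I A)
  case 0
  then show ?case by auto
next
  case (Suc d)
  show ?case
  proof (cases "\<forall>i\<in>I. spread N (c i) A")
    case True
    have "card A \<le> N ^ card I * card A" using Suc by simp
    then show ?thesis using True by (intro exI[of _ A] exI[of _ "{}"]) auto
  next
    case False
    then obtain i y where i: "i \<in> I" and y: "card A < N * card {a \<in> A. c i a = y}"
      unfolding spread_def by (auto simp: not_le)
    have "\<exists>A' J. A' \<subseteq> {a \<in> A. c i a = y} \<and> J \<subseteq> I - {i} \<and>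
      card {a \<in> A. c i a = y} \<le> N ^ card (I - {i}) * card A' \<and>
      (\<forall>i\<in>J. \<forall>x\<in>A'. \<forall>y\<in>A'. c i x = c i y) \<and> (\<forall>j\<in>I - {i} - J. spread N (c j) A')"
      using Suc i by (intro Suc.hyps(1)) auto
    then obtain A' J where A': "A' \<subseteq> {a \<in> A. c i a = y}" "J \<subseteq> I - {i}"
      "card {a \<in> A. c i a = y} \<le> N ^ card (I - {i}) * card A'"
      "\<forall>i\<in>J. \<forall>x\<in>A'. \<forall>y\<in>A'. c i x = c i y" "\<forall>j\<in>I - {i} - J. spread N (c j) A'" by blast
    have "card I = Suc (card (I - {i}))" using i Suc by (metis card.remove)
    then have N: "N ^ card I = N * N ^ card (I - {i})" by (simp only: power_Suc)
    have "card A \<le> N * card {a \<in> A. c i a = y}" using y by simp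
    also have "\<dots> \<le> N * (N ^ card (I - {i}) * card A')" using A'(3) by (rule mult_le_mono2)
    also have "\<dots> = N ^ card I * card A'" unfolding N by (simp only: mult.assoc)
    finally have "card A \<le> N ^ card I * card A'" .
    moreover have "\<forall>j\<in>insert i J. \<forall>x\<in>A'. \<forall>y\<in>A'. c j x = c j y"
    proof (intro ballI)
      fix j x y' assume "j \<in> insert i J" "x \<in> A'" "y' \<in> A'"
      then show "c j x = c j y'"
      proof (cases "j = i")
        case True
        have "c i x = y" "c i y' = y" using A'(1) \<open>x \<in> A'\<close> \<open>y' \<in> A'\<close> by blast+
        then show ?thesis using True by simp
      next
        case False
        then show ?thesis using A'(4) \<open>j \<in> insert i J\<close> \<open>x \<in> A'\<close> \<open>y' \<in> A'\<close> by blast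
      qed
    qed
    moreover have "\<forall>j\<in>I - insert i J. spread N (c j) A'" using A'(5) by blast
    moreover have "A' \<subseteq> A" "insert i J \<subseteq> I" using A'(1,2) i by blast+
    ultimately show ?thesis by blast
  qed
qed

text \<open>The constant in \<open>meet\<close> is the product of two losses:
  \<open>(2 * 4 ^ r) ^ r\<close> from passing to concentrated subsets and \<open>4 ^ r\<close> from
  separating colours. Sets that survive both are still large enough to be forced to agree in some
  colour.\<close>

lemma intersecting_representatives:
  fixes c :: "nat \<Rightarrow> 'a \<Rightarrow> 'b" and m :: real
  assumes fin: "\<And>T. T \<in> I \<Longrightarrow> finite (A T)"
    and m: "m > 0" and large: "\<And>T. T \<in> I \<Longrightarrow> m \<le> card (A T)"
    and meet: "\<And>X Y. X \<subseteq> \<Union>(A ` I) \<Longrightarrow> Y \<subseteq> \<Union>(A ` I) \<Longrightarrow>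
      m \<le> (2 * 4 ^ r) ^ r * 4 ^ r * card X \<Longrightarrow> m \<le> (2 * 4 ^ r) ^ r * 4 ^ r * card Y \<Longrightarrow>
      \<exists>x\<in>X. \<exists>y\<in>Y. \<exists>i<r. c i x = c i y"
  shows "\<exists>w. \<forall>T\<in>I. w T \<in> A T \<and> (\<forall>T'\<in>I. \<exists>i<r. c i (w T) = c i (w T'))"
proof -
  define N :: nat where "N = 2 * 4 ^ r"
  have N: "N > 0" unfolding N_def by simp
  have "\<forall>T\<in>I. \<exists>A' J. A' \<subseteq> A T \<and> J \<subseteq> {..<r} \<and> card (A T) \<le> N ^ r * card A' \<and>
    (\<forall>i\<in>J. \<forall>x\<in>A'. \<forall>y\<in>A'. c i x = c i y) \<and> (\<forall>i\<in>{..<r} - J. spread N (c i) A')"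
    using ex_concentrated_subset[of "{..<r}" _ N c] fin N by simp
  then obtain B J where BJ: "\<And>T. T \<in> I \<Longrightarrow> B T \<subseteq> A T \<and> J T \<subseteq> {..<r} \<and>
      card (A T) \<le> N ^ r * card (B T) \<and>
      (\<forall>i\<in>J T. \<forall>x\<in>B T. \<forall>y\<in>B T. c i x = c i y) \<and> (\<forall>i\<in>{..<r} - J T. spread N (c i) (B T))"
    by metis
  \<comment> \<open>Any element of \<open>B T\<close> may represent \<open>T\<close>: only colours
    constant on \<open>B T\<close> are compared below.\<close>
  define w where "w T = (SOME x. x \<in> B T)" for T
  have w: "w T \<in> B T" if T: "T \<in> I" for T
  proof -
    have "0 < card (A T)" using large[OF T] m by linarith
    moreover have "card (A T) \<le> N ^ r * card (B T)" using BJ[OF T] by blast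
    ultimately have "card (B T) \<noteq> 0" by (metis mult_0_right not_le)
    then have "B T \<noteq> {}" by auto
    then show ?thesis unfolding w_def by (auto intro: someI)
  qed
  have finB: "finite (B T)" if "T \<in> I" for T using that BJ fin by (meson finite_subset)
  have "\<exists>i<r. c i (w T) = c i (w T')" if T: "T \<in> I" and T': "T' \<in> I" for T T'
  proof (rule ccontr)
    assume no: "\<not> (\<exists>i<r. c i (w T) = c i (w T'))"
    \<comment> \<open>A colour in \<open>D\<close> is not fixed on both sets, hence is spread on one
      of them and can be separated. An agreement forced by \<open>meet\<close> afterwards lies
      outside \<open>D\<close>, where both sets are constant, so the representatives agree
      too.\<close>
    define D where "D = {..<r} - J T \<inter> J T'"
    have D: "finite D" "card D \<le> r"
      unfolding D_def using card_mono[of "{..<r}" "{..<r} - J T \<inter> J T'"] by auto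
    have "\<exists>X Y. X \<subseteq> B T \<and> Y \<subseteq> B T' \<and> (\<forall>i\<in>D. c i ` X \<inter> c i ` Y = {}) \<and>
      card (B T) \<le> 4 ^ card D * card X \<and> card (B T') \<le> 4 ^ card D * card Y"
      using D finB[OF T] finB[OF T'] BJ[OF T] BJ[OF T']
      by (intro separate_colours[where r = r]) (auto simp: N_def D_def)
    then obtain X Y where XY: "X \<subseteq> B T" "Y \<subseteq> B T'" "\<forall>i\<in>D. c i ` X \<inter> c i ` Y = {}"
      "card (B T) \<le> 4 ^ card D * card X" "card (B T') \<le> 4 ^ card D * card Y" by blast
    have "(4::nat) ^ card D \<le> 4 ^ r" using D by simp
    then have XY': "card (B T) \<le> 4 ^ r * card X" "card (B T') \<le> 4 ^ r * card Y"
      using XY by (meson mult_le_mono1 order_trans)+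
    have "card (A T) \<le> N ^ r * (4 ^ r * card X)" "card (A T') \<le> N ^ r * (4 ^ r * card Y)"
      using XY' BJ[OF T] BJ[OF T'] by (meson mult_le_mono2 order_trans)+
    then have "real (card (A T)) \<le> real (N ^ r * (4 ^ r * card X))"
      "real (card (A T')) \<le> real (N ^ r * (4 ^ r * card Y))" by (simp_all only: of_nat_le_iff)
    then have "m \<le> (2 * 4 ^ r) ^ r * 4 ^ r * card X" "m \<le> (2 * 4 ^ r) ^ r * 4 ^ r * card Y"
      using large[OF T] large[OF T'] unfolding N_def by (simp_all add: ac_simps)
    then obtain x y i where xy: "x \<in> X" "y \<in> Y" "i < r" "c i x = c i y"
      using meet[of X Y] XY BJ[OF T] BJ[OF T'] T T' by blast
    have "i \<notin> D" using XY(3) xy by blast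
    then have "i \<in> J T" "i \<in> J T'" using xy by (auto simp: D_def)
    then have "c i x = c i (w T)" "c i y = c i (w T')"
      using BJ[OF T] BJ[OF T'] w[OF T] w[OF T'] XY xy by blast+
    then show False using no xy by auto
  qed
  moreover have "w T \<in> A T" if "T \<in> I" for T using w[OF that] BJ[OF that] by auto
  ultimately show ?thesis by blast
qed

section \<open>The component hypergraph\<close>

definition component :: "nat \<Rightarrow> nat set set \<Rightarrow> nat \<Rightarrow> nat set" where
  "component n E v = {u \<in> {..<n}. (v, u) \<in> {(x, y). {x, y} \<in> E}\<^sup>*}"

lemma component_eq_if_adjacent:
  assumes "{x, y} \<in> E"
  shows "component n E x = component n E y"
proof -
  let ?R = "{(x, y). {x, y} \<in> E}"
  have "(x, y) \<in> ?R" "(y, x) \<in> ?R" using assms by (auto simp: insert_commute)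
  then have "(x, u) \<in> ?R\<^sup>* \<longleftrightarrow> (y, u) \<in> ?R\<^sup>*" for u by (meson converse_rtrancl_into_rtrancl)
  then show ?thesis unfolding component_def by simp
qed

lemma component_mem: "v < n \<Longrightarrow> v \<in> component n E v"
  unfolding component_def by simp

lemma graph_components_eq: "graph_components {..<n} E = component n E ` {..<n}"
  unfolding graph_components_def component_def by simp

lemma mono_components_eq:
  "mono_components r {..<n} E f = (\<Union>i<r. component n {e \<in> E. f e = i} ` {..<n})"
  unfolding mono_components_def graph_components_eq ..

text \<open>
  The vertex of the component hypergraph given by the component of colour \<open>i\<close> containing \<open>v\<close>,
  coded as a natural number because \<^const>\<open>kc\<close> only speaks about hypergraphs on \<^typ>\<open>nat\<close>.
\<close>

definition component_code :: "nat \<Rightarrow> nat set set \<Rightarrow> (nat set \<Rightarrow> nat) \<Rightarrow> nat \<Rightarrow> nat \<Rightarrow> nat" where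
  "component_code n E f i v = prod_encode (i, set_encode (component n {e \<in> E. f e = i} v))"

lemma component_code_eq_iff:
  "component_code n E f i v = component_code n E f j u \<longleftrightarrow>
     i = j \<and> component n {e \<in> E. f e = i} v = component n {e \<in> E. f e = j} u"
  unfolding component_code_def component_def by (auto simp: set_encode_eq)

lemma decode_component_code:
  "set_decode (snd (prod_decode (component_code n E f i v))) = component n {e \<in> E. f e = i} v"
  unfolding component_code_def component_def by simp

definition component_edge :: "nat \<Rightarrow> nat \<Rightarrow> nat set set \<Rightarrow> (nat set \<Rightarrow> nat) \<Rightarrow> nat \<Rightarrow> nat set" where
  "component_edge r n E f v = (\<lambda>i. component_code n E f i v) ` {..<r}"

lemma component_edges_meet_iff:
  "component_edge r n E f u \<inter> component_edge r n E f v \<noteq> {} \<longleftrightarrow>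
     (\<exists>i<r. component_code n E f i u = component_code n E f i v)"
  unfolding component_edge_def by (auto simp: component_code_eq_iff)

lemma component_edges_meet_if_adjacent:
  assumes "f \<in> E \<rightarrow> {..<r}" "{u, v} \<in> E"
  shows "component_edge r n E f u \<inter> component_edge r n E f v \<noteq> {}"
proof -
  have "component n {e \<in> E. f e = f {u, v}} u = component n {e \<in> E. f e = f {u, v}} v"
    using assms by (intro component_eq_if_adjacent) auto
  then show ?thesis
    using assms unfolding component_edges_meet_iff component_code_eq_iff by auto
qed

text \<open>The parts are the colours. The same vertex set may be a component in two colours; the
  code records the colour, so it then gives two vertices of the hypergraph, and every hyperedge has
  exactly \<open>r\<close> elements.\<close>

lemma partite_component_hypergraph:
  "partite_hypergraph r (\<Union>i<r. component_code n E f i ` {..<n})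
     (component_edge r n E f ` {..<n})"
proof -
  let ?P = "\<lambda>i. component_code n E f i ` {..<n}"
  have "inj_on (\<lambda>i. component_code n E f i v) {..<r}" for v
    by (intro inj_onI) (simp add: component_code_eq_iff)
  then have "card (component_edge r n E f v) = r" for v
    unfolding component_edge_def by (simp add: card_image)
  then have "uniform_hypergraph r (\<Union>i<r. ?P i) (component_edge r n E f ` {..<n})"
    unfolding uniform_hypergraph_def by (auto simp: component_edge_def)
  moreover have "component_edge r n E f v \<inter> ?P i = {component_code n E f i v}"
    if "v < n" "i < r" for v i
    using that unfolding component_edge_def by (auto simp: component_code_eq_iff)
  then have "\<forall>e\<in>component_edge r n E f ` {..<n}. \<forall>i<r. card (e \<inter> ?P i) = 1" by simp
  moreover have "disjoint_family_on ?P {..<r}"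
    unfolding disjoint_family_on_def by (auto simp: component_code_eq_iff)
  ultimately show ?thesis unfolding partite_hypergraph_def by blast
qed

lemma ex_cover_card_eq_cover_number:
  assumes "finite V" "\<And>e. e \<in> E \<Longrightarrow> e \<subseteq> V \<and> e \<noteq> {}"
  shows "\<exists>S\<subseteq>V. finite S \<and> edge_cover S E \<and> card S = cover_number V E"
  unfolding cover_number_def
proof (rule LeastI_ex)
  have "edge_cover V E" unfolding edge_cover_def using assms(2) by blast
  then show "\<exists>m. \<exists>S\<subseteq>V. finite S \<and> edge_cover S E \<and> card S = m" using assms(1) by blast
qed

lemma cover_number_le: "S \<subseteq> V \<Longrightarrow> finite S \<Longrightarrow> edge_cover S E \<Longrightarrow> cover_number V E \<le> card S"
  unfolding cover_number_def by (rule Least_le) blast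

lemma partite_hypergraph_nonempty_edge:
  "partite_hypergraph r V E \<Longrightarrow> r > 0 \<Longrightarrow> e \<in> E \<Longrightarrow> e \<subseteq> V \<and> e \<noteq> {}"
  unfolding partite_hypergraph_def uniform_hypergraph_def by fastforce

section \<open>Upper bound: intersecting covers of the component hypergraph\<close>

definition common_neighbours :: "nat \<Rightarrow> nat set set \<Rightarrow> nat set \<Rightarrow> nat set" where
  "common_neighbours n E S = {v \<in> {..<n}. \<forall>x\<in>S. {x, v} \<in> E}"

text \<open>\<open>intersecting_representatives\<close> is applied to common neighbourhoods of
  \<open>k\<close> vertices. The ends of an edge lie in one component of its colour, so the
  hyperedge of a common neighbour meets every hyperedge of the tuple. Edges between large disjoint
  sets supply \<open>meet\<close>.\<close>

lemma intersecting_covers_component_hypergraph: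
  fixes m :: real
  assumes "r > 0" and f: "f \<in> E \<rightarrow> {..<r}" and m: "m > 0"
    and common: "\<And>xs. length xs = k \<Longrightarrow> set xs \<subseteq> {..<n} \<Longrightarrow> m \<le> card (common_neighbours n E (set xs))"
    and edge: "\<And>X Y. X \<subseteq> {..<n} \<Longrightarrow> Y \<subseteq> {..<n} \<Longrightarrow> X \<inter> Y = {} \<Longrightarrow>
      m \<le> (2 * 4 ^ r) ^ r * 4 ^ r * card X \<Longrightarrow> m \<le> (2 * 4 ^ r) ^ r * 4 ^ r * card Y \<Longrightarrow>
      \<exists>x\<in>X. \<exists>y\<in>Y. {x, y} \<in> E"
  shows "intersecting_covers k (component_edge r n E f ` {..<n})"
proof -
  define h where "h = component_edge r n E f"
  \<comment> \<open>Several vertices may give the same hyperedge; one of them is fixed.\<close>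
  define rep where "rep e = (SOME v. v < n \<and> h v = e)" for e
  have rep: "rep e < n \<and> h (rep e) = e" if "e \<in> h ` {..<n}" for e
  proof -
    have "\<exists>v. v < n \<and> h v = e" using that by blast
    then obtain v where "v < n \<and> h v = e" ..
    then show ?thesis unfolding rep_def by (rule someI)
  qed
  let ?I = "edge_tuples k (h ` {..<n})"
  define A where "A T = common_neighbours n E (set (map rep T))" for T
  have sub: "A T \<subseteq> {..<n}" for T unfolding A_def common_neighbours_def by auto
  have "\<exists>w. \<forall>T\<in>?I. w T \<in> A T \<and>
      (\<forall>T'\<in>?I. \<exists>i<r. component_code n E f i (w T) = component_code n E f i (w T'))"
  proof (rule intersecting_representatives[OF _ m])
    show "finite (A T)" for T using sub finite_subset by blast
    show "m \<le> card (A T)" if "T \<in> ?I" for T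
      unfolding A_def using that rep by (intro common) (auto simp: edge_tuples_def)
    fix X Y assume XY: "X \<subseteq> \<Union>(A ` ?I)" "Y \<subseteq> \<Union>(A ` ?I)"
      "m \<le> (2 * 4 ^ r) ^ r * 4 ^ r * card X" "m \<le> (2 * 4 ^ r) ^ r * 4 ^ r * card Y"
    show "\<exists>x\<in>X. \<exists>y\<in>Y. \<exists>i<r. component_code n E f i x = component_code n E f i y"
    proof (cases "X \<inter> Y = {}")
      case True
      have "X \<subseteq> {..<n}" "Y \<subseteq> {..<n}" using XY sub by blast+
      then obtain x y where "x \<in> X" "y \<in> Y" "{x, y} \<in> E" using edge[of X Y] XY True by blast
      then show ?thesis
        using component_edges_meet_if_adjacent[OF f] unfolding component_edges_meet_iff by blast
    next
      case False
      \<comment> \<open>A common vertex agrees with itself in every colour, and \<open>r > 0\<close>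
        provides one.\<close>
      then show ?thesis using \<open>r > 0\<close> by blast
    qed
  qed
  then obtain w where w: "\<And>T. T \<in> ?I \<Longrightarrow> w T \<in> A T"
    "\<And>T T'. T \<in> ?I \<Longrightarrow> T' \<in> ?I \<Longrightarrow> h (w T) \<inter> h (w T') \<noteq> {}"
    unfolding h_def component_edges_meet_iff by blast
  have "h (w T) \<inter> e \<noteq> {}" if T: "T \<in> ?I" and e: "e \<in> set T" for T e
  proof -
    have "e \<in> h ` {..<n}" using T e unfolding edge_tuples_def by blast
    moreover have "{rep e, w T} \<in> E" using w(1)[OF T] e unfolding A_def common_neighbours_def by auto
    ultimately show ?thesis
      using component_edges_meet_if_adjacent[OF f] rep unfolding h_def by (metis Int_commute)
  qed
  moreover have "(\<lambda>T. h (w T)) \<in> ?I \<rightarrow> h ` {..<n}" using w(1) sub by blast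
  ultimately show ?thesis unfolding intersecting_covers_def h_def[symmetric]
    using w(2) by (intro exI[of _ "\<lambda>T. h (w T)"]) blast
qed

lemma tc_le_if_covers_intersecting:
  fixes m :: real
  assumes r: "r > 0" and m: "m > 0"
    and kc: "\<And>(V :: nat set) H. partite_hypergraph r V H \<Longrightarrow> intersecting_covers k H \<Longrightarrow> cover_number V H \<le> t"
    and common: "\<And>xs. length xs = k \<Longrightarrow> set xs \<subseteq> {..<n} \<Longrightarrow> m \<le> card (common_neighbours n E (set xs))"
    and edge: "\<And>X Y. X \<subseteq> {..<n} \<Longrightarrow> Y \<subseteq> {..<n} \<Longrightarrow> X \<inter> Y = {} \<Longrightarrow>
      m \<le> (2 * 4 ^ r) ^ r * 4 ^ r * card X \<Longrightarrow> m \<le> (2 * 4 ^ r) ^ r * 4 ^ r * card Y \<Longrightarrow>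
      \<exists>x\<in>X. \<exists>y\<in>Y. {x, y} \<in> E"
  shows "tc r {..<n} E \<le> t"
  unfolding tc_def
proof (intro Least_le ballI)
  fix f assume f: "f \<in> E \<rightarrow> {..<r}"
  let ?c = "component_code n E f" and ?h = "component_edge r n E f"
  let ?V = "\<Union>i<r. ?c i ` {..<n}"
  have "intersecting_covers k (?h ` {..<n})"
    by (rule intersecting_covers_component_hypergraph[OF r f m common edge])
  then have le: "cover_number ?V (?h ` {..<n}) \<le> t"
    using kc[OF partite_component_hypergraph] by blast
  have "\<exists>S\<subseteq>?V. finite S \<and> edge_cover S (?h ` {..<n}) \<and> card S = cover_number ?V (?h ` {..<n})"
    using partite_hypergraph_nonempty_edge[OF partite_component_hypergraph r]
    by (intro ex_cover_card_eq_cover_number) auto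
  then obtain S where S: "S \<subseteq> ?V" "finite S" "edge_cover S (?h ` {..<n})" "card S \<le> t"
    using le by auto
  \<comment> \<open>Decoding forgets the colour, so two elements of \<open>S\<close> may give the
    same vertex set; the cardinality can only drop.\<close>
  let ?C = "(\<lambda>x. set_decode (snd (prod_decode x))) ` S"
  have "?C \<subseteq> mono_components r {..<n} E f"
  proof
    fix C assume "C \<in> ?C"
    then obtain i v where "i < r" "v < n" "C = set_decode (snd (prod_decode (?c i v)))"
      using S(1) by blast
    then show "C \<in> mono_components r {..<n} E f"
      unfolding mono_components_eq decode_component_code by blast
  qed
  moreover have "card ?C \<le> t" using S card_image_le by (meson order_trans)
  moreover have "v \<in> \<Union>?C" if v: "v < n" for v
  proof -
    obtain i where "?c i v \<in> S"
      using S(3) v unfolding edge_cover_def component_edge_def by blast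
    then have "set_decode (snd (prod_decode (?c i v))) \<in> ?C" by (rule imageI)
    then have "component n {e \<in> E. f e = i} v \<in> ?C" unfolding decode_component_code .
    then show ?thesis using component_mem[OF v] by blast
  qed
  ultimately show "\<exists>\<C>. \<C> \<subseteq> mono_components r {..<n} E f \<and> finite \<C> \<and> card \<C> \<le> t \<and> {..<n} \<subseteq> \<Union>\<C>"
    using S(2) by (intro exI[of _ ?C]) auto
qed

section \<open>Lower bound: colourings obtained from a hypergraph\<close>

text \<open>The minimum defining \<open>tc\<close> is attained: for every colouring the components
  of colour 0 cover all vertices, and there are at most \<open>n\<close> of them.\<close>

lemma coloured_cover_le_tc:
  fixes E :: "nat set set"
  assumes r: "r > 0" and f: "f \<in> E \<rightarrow> {..<r}"
  shows "\<exists>\<C>. \<C> \<subseteq> mono_components r {..<n} E f \<and> finite \<C> \<and> card \<C> \<le> tc r {..<n} E \<and> {..<n} \<subseteq> \<Union>\<C>"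
proof -
  define Q where "Q m \<longleftrightarrow> (\<forall>f \<in> E \<rightarrow> {..<r}.
     \<exists>\<C>. \<C> \<subseteq> mono_components r {..<n} E f \<and> finite \<C> \<and> card \<C> \<le> m \<and> {..<n} \<subseteq> \<Union>\<C>)" for m
  have "Q n" unfolding Q_def
  proof
    fix f :: "nat set \<Rightarrow> nat"
    let ?C = "component n {e \<in> E. f e = 0} ` {..<n}"
    have "?C \<subseteq> mono_components r {..<n} E f" using r unfolding mono_components_eq by blast
    moreover have "card ?C \<le> n" using card_image_le[of "{..<n}"] by simp
    moreover have "{..<n} \<subseteq> \<Union>?C" using component_mem by blast
    ultimately show "\<exists>\<C>. \<C> \<subseteq> mono_components r {..<n} E f \<and> finite \<C> \<and> card \<C> \<le> n \<and> {..<n} \<subseteq> \<Union>\<C>"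
      by (intro exI[of _ ?C]) simp
  qed
  then have "Q (tc r {..<n} E)" unfolding tc_def Q_def[symmetric] by (rule LeastI)
  then show ?thesis using f unfolding Q_def by blast
qed

text \<open>
  A vertex outside \<open>u ` H\<close> receives the cover of its at most \<open>k - 1\<close> neighbours in \<open>u ` H\<close>, so
  adjacent vertices carry intersecting hyperedges and an edge can be coloured by a common part.
\<close>

lemma ex_hyperedge_labelling:
  assumes u: "inj_on u H" and H: "finite H" "H \<noteq> {}" "\<And>e. e \<in> H \<Longrightarrow> e \<noteq> {}"
    and ind: "\<And>x y. x \<in> u ` H \<Longrightarrow> y \<in> u ` H \<Longrightarrow> {x, y} \<notin> E"
    and few: "\<And>w. w \<notin> u ` H \<Longrightarrow> card {x \<in> u ` H. {w, x} \<in> E} \<le> k"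
    and cov: "intersecting_covers k H"
  shows "\<exists>h. (\<forall>v. h v \<in> H) \<and> (\<forall>e\<in>H. h (u e) = e) \<and> (\<forall>x y. {x, y} \<in> E \<longrightarrow> h x \<inter> h y \<noteq> {})"
proof -
  obtain \<phi> where \<phi>: "\<phi> \<in> edge_tuples k H \<rightarrow> H"
    "\<And>T e. T \<in> edge_tuples k H \<Longrightarrow> e \<in> set T \<Longrightarrow> \<phi> T \<inter> e \<noteq> {}"
    "\<And>T T'. T \<in> edge_tuples k H \<Longrightarrow> T' \<in> edge_tuples k H \<Longrightarrow> \<phi> T \<inter> \<phi> T' \<noteq> {}"
  proof -
    obtain \<phi> where \<phi>: "\<phi> \<in> edge_tuples k H \<rightarrow> H"
      "\<forall>T\<in>edge_tuples k H. \<forall>e\<in>set T. \<phi> T \<inter> e \<noteq> {}"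
      "\<forall>T\<in>edge_tuples k H. \<forall>T'\<in>edge_tuples k H. \<phi> T \<inter> \<phi> T' \<noteq> {}"
      using cov unfolding intersecting_covers_def by (elim exE conjE)
    then show ?thesis by (intro that[of \<phi>]) simp_all
  qed
  obtain e0 where e0: "e0 \<in> H" using H by blast
  have "\<exists>T. T \<in> edge_tuples k H \<and> {e \<in> H. {w, u e} \<in> E} \<subseteq> set T" if w: "w \<notin> u ` H" for w
  proof -
    let ?N = "{e \<in> H. {w, u e} \<in> E}"
    obtain xs where xs: "set xs = ?N" "distinct xs"
      using finite_distinct_list[of ?N] H by auto
    have "u ` ?N = {x \<in> u ` H. {w, x} \<in> E}" by auto
    then have "card ?N \<le> k" using few[OF w] u
      by (metis (no_types, lifting) card_image inj_on_subset mem_Collect_eq subsetI)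
    then have "length xs \<le> k" using xs distinct_card by fastforce
    \<comment> \<open>Tuples have length exactly \<open>k\<close>, so a shorter list is padded with
      an arbitrary edge.\<close>
    then have "length (xs @ replicate (k - length xs) e0) = k" by simp
    moreover have "set (xs @ replicate (k - length xs) e0) \<subseteq> H"
    proof -
      have "set xs \<subseteq> H" unfolding xs(1) by blast
      then show ?thesis using e0 by (simp add: set_replicate_conv_if)
    qed
    moreover have "?N \<subseteq> set (xs @ replicate (k - length xs) e0)" unfolding xs(1)[symmetric] by simp
    ultimately show ?thesis unfolding edge_tuples_def by blast
  qed
  then have "\<forall>w. \<exists>T. w \<notin> u ` H \<longrightarrow> T \<in> edge_tuples k H \<and> {e \<in> H. {w, u e} \<in> E} \<subseteq> set T" by blast
  then obtain T where "\<forall>w. w \<notin> u ` H \<longrightarrow> T w \<in> edge_tuples k H \<and> {e \<in> H. {w, u e} \<in> E} \<subseteq> set (T w)"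
    by (rule choice[THEN exE])
  then have T: "\<And>w. w \<notin> u ` H \<Longrightarrow> T w \<in> edge_tuples k H"
    "\<And>w e. w \<notin> u ` H \<Longrightarrow> e \<in> H \<Longrightarrow> {w, u e} \<in> E \<Longrightarrow> e \<in> set (T w)" by auto
  define h where "h v = (if v \<in> u ` H then the_inv_into H u v else \<phi> (T v))" for v
  have hu: "h (u e) = e" if "e \<in> H" for e
    using that u by (simp add: h_def the_inv_into_f_f)
  have hout: "h w = \<phi> (T w)" if "w \<notin> u ` H" for w using that by (simp add: h_def)
  have hH: "h v \<in> H" for v
  proof (cases "v \<in> u ` H")
    case True
    then show ?thesis using hu by auto
  next
    case False
    then show ?thesis using hout T(1) \<phi>(1) by auto
  qed
  \<comment> \<open>A neighbour in the block has its hyperedge in the tuple of \<open>x\<close> and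
    is met as an entry of it; for a neighbour outside, two values of \<open>\<phi>\<close>
    intersect.\<close>
  have one: "h x \<inter> h y \<noteq> {}" if E: "{x, y} \<in> E" and x: "x \<notin> u ` H" for x y
  proof (cases "y \<in> u ` H")
    case True
    then obtain e where e: "e \<in> H" "y = u e" by auto
    then show ?thesis using \<phi>(2)[OF T(1)[OF x] T(2)[OF x]] E hu hout[OF x] by simp
  next
    case False
    then show ?thesis using \<phi>(3)[OF T(1)[OF x] T(1)] x hout by simp
  qed
  have "h x \<inter> h y \<noteq> {}" if E: "{x, y} \<in> E" for x y
    using one[OF E] one[of y x] E ind[of x y] by (auto simp: insert_commute Int_commute)
  then show ?thesis using hu hH by blast
qed

text \<open>Colour an edge by a part containing a common element of the labels at its ends. A label
  meets each part in exactly one element, so the element in part \<open>i\<close> is constant along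
  every component of colour \<open>i\<close>. Replacing each component of a cover by this element
  gives a cover of \<open>H\<close>, because the vertex \<open>u e\<close> is labelled
  \<open>e\<close>.\<close>

lemma tc_gt_if_independent_embedding:
  assumes r: "r > 0" and part: "partite_hypergraph r V H" and cov: "intersecting_covers k H"
    and cn: "cover_number V H > t" and H: "H \<noteq> {}" and E: "E \<subseteq> vertex_pairs n"
    and u: "inj_on u H" "u ` H \<subseteq> {..<n}"
    and ind: "\<And>x y. x \<in> u ` H \<Longrightarrow> y \<in> u ` H \<Longrightarrow> {x, y} \<notin> E"
    and few: "\<And>w. w < n \<Longrightarrow> w \<notin> u ` H \<Longrightarrow> card {x \<in> u ` H. {w, x} \<in> E} \<le> k"
  shows "tc r {..<n} E > t"
proof -
  have ne: "e \<subseteq> V \<and> e \<noteq> {}" if "e \<in> H" for e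
    using partite_hypergraph_nonempty_edge[OF part r that] .
  obtain P where P: "\<And>e i. e \<in> H \<Longrightarrow> i < r \<Longrightarrow> card (e \<inter> P i) = 1" "V = (\<Union>i<r. P i)" "finite V"
    using part unfolding partite_hypergraph_def uniform_hypergraph_def by blast
  have "finite H" using ne P(3) by (meson PowI finite_Pow_iff finite_subset subsetI)
  \<comment> \<open>The labelling is made on all natural numbers; those from \<open>n\<close> on are
    isolated in \<open>E\<close>.\<close>
  have few': "card {x \<in> u ` H. {w, x} \<in> E} \<le> k" if "w \<notin> u ` H" for w
  proof (cases "w < n")
    case False
    then have "{w, x} \<notin> E" for x using E unfolding vertex_pairs_def by auto
    then have "{x \<in> u ` H. {w, x} \<in> E} = {}" by simp
    then show ?thesis by (simp only: card.empty)
  next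
    case True
    then show ?thesis using few that by blast
  qed
  obtain h where h: "\<And>v. h v \<in> H" "\<And>e. e \<in> H \<Longrightarrow> h (u e) = e"
    "\<And>x y. {x, y} \<in> E \<Longrightarrow> h x \<inter> h y \<noteq> {}"
  proof -
    have "\<exists>h. (\<forall>v. h v \<in> H) \<and> (\<forall>e\<in>H. h (u e) = e) \<and> (\<forall>x y. {x, y} \<in> E \<longrightarrow> h x \<inter> h y \<noteq> {})"
      using ne by (intro ex_hyperedge_labelling[OF u(1) \<open>finite H\<close> H _ ind few' cov]) blast
    then obtain h where "\<forall>v. h v \<in> H" "\<forall>e\<in>H. h (u e) = e"
      "\<forall>x y. {x, y} \<in> E \<longrightarrow> h x \<inter> h y \<noteq> {}" by (elim exE conjE)
    then show ?thesis by (intro that[of h]) simp_all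
  qed
  define f where "f e = (SOME i. i < r \<and> (\<exists>z\<in>P i. \<forall>x\<in>e. z \<in> h x))" for e
  have f: "f e < r \<and> (\<exists>z\<in>P (f e). \<forall>x\<in>e. z \<in> h x)" if e: "e \<in> E" for e
  proof -
    obtain x y where xy: "e = {x, y}"
      using e E unfolding vertex_pairs_def by (auto simp: card_2_iff)
    then obtain z where z: "z \<in> h x" "z \<in> h y" using h(3) e by blast
    then obtain i where "i < r" "z \<in> P i" using ne[OF h(1)] P(2) by blast
    then have "\<exists>i. i < r \<and> (\<exists>z\<in>P i. \<forall>x\<in>e. z \<in> h x)" using z xy by blast
    then show ?thesis unfolding f_def by (rule someI_ex)
  qed
  have const: "h v \<inter> P i = h x \<inter> P i"
    if i: "i < r" and x: "(v, x) \<in> {(x, y). {x, y} \<in> {e \<in> E. f e = i}}\<^sup>*" for v x i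
    using x
  proof (induction rule: rtrancl_induct)
    case (step y z)
    then have "{y, z} \<in> E" "f {y, z} = i" by auto
    then obtain s where s: "s \<in> h y \<inter> P i" "s \<in> h z \<inter> P i" using f by blast
    obtain s1 s2 where "h y \<inter> P i = {s1}" "h z \<inter> P i = {s2}"
      using P(1)[OF h(1) i] by (metis card_1_singletonE)
    then show ?case using step s by simp
  qed simp
  show ?thesis
  proof (rule ccontr)
    assume "\<not> ?thesis"
    moreover have "f \<in> E \<rightarrow> {..<r}" using f by auto
    ultimately obtain \<C> where C: "\<C> \<subseteq> mono_components r {..<n} E f" "finite \<C>" "card \<C> \<le> t"
      "{..<n} \<subseteq> \<Union>\<C>"
      using coloured_cover_le_tc[OF r, of f E n] by (meson not_le order_trans)
    have "\<exists>z. z \<in> V \<and> (\<forall>x\<in>C. z \<in> h x)" if CC: "C \<in> \<C>" for C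
    proof -
      obtain i v where iv: "i < r" "C = component n {e \<in> E. f e = i} v"
        using C(1) CC unfolding mono_components_eq by auto
      obtain z where "h v \<inter> P i = {z}" using P(1)[OF h(1) iv(1)] by (metis card_1_singletonE)
      then have "z \<in> V" "\<And>x. x \<in> C \<Longrightarrow> z \<in> h x"
        using const[OF iv(1)] iv P(2) unfolding component_def by blast+
      then show ?thesis by blast
    qed
    then obtain z where z: "\<And>C. C \<in> \<C> \<Longrightarrow> z C \<in> V" "\<And>C x. C \<in> \<C> \<Longrightarrow> x \<in> C \<Longrightarrow> z C \<in> h x" by metis
    have "edge_cover (z ` \<C>) H" unfolding edge_cover_def
    proof
      fix e assume e: "e \<in> H"
      then obtain C where "C \<in> \<C>" "u e \<in> C" using C(4) u(2) by blast
      then show "z ` \<C> \<inter> e \<noteq> {}" using z(2)[of C "u e"] h(2)[OF e] by auto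
    qed
    then have "cover_number V H \<le> card (z ` \<C>)" using z(1) C(2) by (intro cover_number_le) auto
    also have "\<dots> \<le> t" using C(2,3) card_image_le order_trans by blast
    finally show False using cn by simp
  qed
qed

section \<open>Consequences of the value of \<open>kc\<close>, and the case of empty tuples\<close>

text \<open>A finite infimum comes from a nonempty set and is attained, since \<open>enat\<close> is
  well-ordered. A smaller positive \<open>j\<close> without a counterexample would lower it.\<close>

lemma kc_eq_enatD:
  assumes "kc r t = enat k"
  shows "k > 0"
    and "\<And>(V :: nat set) H. partite_hypergraph r V H \<Longrightarrow> intersecting_covers k H \<Longrightarrow> cover_number V H \<le> t"
    and "\<And>j. 0 < j \<Longrightarrow> j < k \<Longrightarrow> \<exists>(V :: nat set) H. partite_hypergraph r V H \<and>
      intersecting_covers j H \<and> cover_number V H > t"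
proof -
  define Q where "Q k \<longleftrightarrow> k > 0 \<and> (\<forall>(V :: nat set) E. partite_hypergraph r V E \<longrightarrow>
    intersecting_covers k E \<longrightarrow> cover_number V E \<le> t)" for k
  have kc: "kc r t = Inf {enat k | k. Q k}" unfolding kc_def Q_def ..
  have "{enat k | k. Q k} \<noteq> {}"
  proof
    assume "{enat k | k. Q k} = {}"
    then have "kc r t = \<infinity>" unfolding kc by (simp only: Inf_empty top_enat_def)
    then show False using assms by simp
  qed
  then have "kc r t \<in> {enat k | k. Q k}" unfolding kc by (meson ex_in_conv wellorder_InfI)
  then have "Q k" using assms by auto
  then show "k > 0" "\<And>(V :: nat set) H. partite_hypergraph r V H \<Longrightarrow> intersecting_covers k H \<Longrightarrow> cover_number V H \<le> t"
    unfolding Q_def by auto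
  fix j assume j: "0 < j" "j < k"
  have "\<not> Q j"
  proof
    assume "Q j"
    then have "kc r t \<le> enat j" unfolding kc by (intro Inf_lower) auto
    then show False using j assms by simp
  qed
  then show "\<exists>(V :: nat set) H. partite_hypergraph r V H \<and> intersecting_covers j H \<and> cover_number V H > t"
    using j unfolding Q_def by (auto simp: not_le)
qed

text \<open>Serves \<open>k = 1\<close>, where minimality of \<open>kc\<close> says nothing about
  tuples of length 0. The only such tuple is empty, so a constant choice of one nonempty edge is an
  intersecting cover, while \<open>t + 1\<close> disjoint edges need \<open>t + 1\<close> vertices
  to cover them.\<close>

lemma ex_disjoint_edges:
  assumes r: "r > 0"
  shows "\<exists>(V :: nat set) H. partite_hypergraph r V H \<and> intersecting_covers 0 H \<and> cover_number V H > t"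
proof -
  define h where "h j = (\<lambda>i. prod_encode (i, j)) ` {..<r}" for j
  define P where "P i = (\<lambda>j. prod_encode (i, j)) ` {..t}" for i
  let ?V = "\<Union>i<r. P i" and ?H = "h ` {..t}"
  have hP: "h j \<inter> P i = {prod_encode (i, j)}" if "j \<le> t" "i < r" for i j
    using that unfolding h_def P_def by auto
  have disj: "h j \<inter> h j' = {}" if "j \<noteq> j'" for j j' using that unfolding h_def by auto
  have card_h: "card (h j) = r" for j unfolding h_def by (subst card_image) (auto intro: inj_onI)
  have "disjoint_family_on P {..<r}" unfolding disjoint_family_on_def P_def by auto
  moreover have "\<forall>e\<in>?H. \<forall>i<r. card (e \<inter> P i) = 1" using hP by simp
  moreover have "uniform_hypergraph r ?V ?H"
    unfolding uniform_hypergraph_def using card_h by (auto simp: P_def h_def)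
  ultimately have part: "partite_hypergraph r ?V ?H" unfolding partite_hypergraph_def by blast
  moreover have "h 0 \<noteq> {}" using r by (auto simp: h_def)
  then have "intersecting_covers 0 ?H"
    unfolding intersecting_covers_def edge_tuples_def by (intro exI[of _ "\<lambda>_. h 0"]) auto
  moreover have "t < cover_number ?V ?H"
  proof -
    have "finite ?V" unfolding P_def by simp
    then obtain S where S: "finite S" "edge_cover S ?H" "card S = cover_number ?V ?H"
      using ex_cover_card_eq_cover_number[of ?V ?H] partite_hypergraph_nonempty_edge[OF part r] by blast
    then have "\<forall>j\<in>{..t}. \<exists>s. s \<in> S \<inter> h j" unfolding edge_cover_def by blast
    then obtain s where s: "\<And>j. j \<le> t \<Longrightarrow> s j \<in> S \<inter> h j" by (metis atMost_iff)
    have "inj_on s {..t}" using s disj by (intro inj_onI) (metis IntE IntI atMost_iff empty_iff)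
    moreover have "s ` {..t} \<subseteq> S" using s by auto
    ultimately have "card {..t} \<le> card S" using S(1) by (rule card_inj_on_le)
    then show ?thesis using S(3) by simp
  qed
  ultimately show ?thesis by blast
qed

section \<open>Independent edges\<close>

abbreviation edge_pmf :: "'e set \<Rightarrow> real \<Rightarrow> ('e \<Rightarrow> bool) pmf" where
  "edge_pmf S p \<equiv> Pi_pmf S False (\<lambda>_. bernoulli_pmf p)"

text \<open>Stands in for measurability with respect to the coordinates in \<open>F\<close>. The
  result type is left open so that both events and real-valued functions fit.\<close>

definition depends_on :: "'e set \<Rightarrow> (('e \<Rightarrow> bool) \<Rightarrow> 'c) \<Rightarrow> bool" where
  "depends_on F g \<longleftrightarrow> (\<forall>f f'. (\<forall>e\<in>F. f e = f' e) \<longrightarrow> g f = g f')"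

lemma depends_onD: "depends_on F g \<Longrightarrow> (\<And>e. e \<in> F \<Longrightarrow> f e = f' e) \<Longrightarrow> g f = g f'"
  unfolding depends_on_def by blast

lemma finite_set_edge_pmf: "finite S \<Longrightarrow> finite (set_pmf (edge_pmf S p))"
  by (rule finite_subset[OF set_Pi_pmf_subset']) auto

lemma integrable_edge_pmf:
  fixes g :: "('e \<Rightarrow> bool) \<Rightarrow> real"
  shows "finite S \<Longrightarrow> integrable (measure_pmf (edge_pmf S p)) g"
  by (intro integrable_measure_pmf_finite finite_set_edge_pmf)

lemma expectation_pair_pmf_mult:
  fixes g :: "'a \<Rightarrow> real" and h :: "'b \<Rightarrow> real"
  assumes "finite (set_pmf P)" "finite (set_pmf Q)"
  shows "measure_pmf.expectation (pair_pmf P Q) (\<lambda>(x, y). g x * h y) =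
    measure_pmf.expectation P g * measure_pmf.expectation Q h"
proof -
  have "measure_pmf.expectation (pair_pmf P Q) (\<lambda>(x, y). g x * h y) =
    (\<Sum>(x, y)\<in>set_pmf P \<times> set_pmf Q. (g x * pmf P x) * (h y * pmf Q y))"
    using assms
    by (subst integral_measure_pmf_real[where A = "set_pmf P \<times> set_pmf Q"])
       (auto simp: pmf_pair case_prod_unfold ac_simps intro!: sum.cong)
  also have "\<dots> = (\<Sum>x\<in>set_pmf P. g x * pmf P x) * (\<Sum>y\<in>set_pmf Q. h y * pmf Q y)"
    by (simp add: sum_product sum.cartesian_product)
  also have "\<dots> = measure_pmf.expectation P g * measure_pmf.expectation Q h"
    using assms by (subst (1 2) integral_measure_pmf_real) auto
  finally show ?thesis .
qed

text \<open>Splitting the coordinates into \<open>S \<inter> F\<close> and \<open>S - F\<close>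
  makes the distribution a product. The first factor determines \<open>g\<close>, and the second
  determines \<open>h\<close> because \<open>F'\<close> avoids \<open>F\<close>.\<close>

lemma expectation_mult_edge_pmf:
  fixes g h :: "('e \<Rightarrow> bool) \<Rightarrow> real"
  assumes S: "finite S" and disj: "F \<inter> F' = {}" and g: "depends_on F g" and h: "depends_on F' h"
  shows "measure_pmf.expectation (edge_pmf S p) (\<lambda>f. g f * h f) =
    measure_pmf.expectation (edge_pmf S p) g * measure_pmf.expectation (edge_pmf S p) h"
proof -
  let ?A = "S \<inter> F" and ?B = "S - F"
  let ?P = "edge_pmf ?A p" and ?Q = "edge_pmf ?B p"
  let ?j = "\<lambda>(f, g) x. if x \<in> ?A then f x else g x"
  have un: "edge_pmf S p = map_pmf ?j (pair_pmf ?P ?Q)"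
  proof -
    have "edge_pmf (?A \<union> ?B) p = map_pmf ?j (pair_pmf ?P ?Q)"
      using S by (intro Pi_pmf_union) auto
    moreover have "?A \<union> ?B = S" by blast
    ultimately show ?thesis by (simp only:)
  qed
  have fin: "finite (set_pmf ?P)" "finite (set_pmf ?Q)" using S by (simp_all add: finite_set_edge_pmf)
  \<comment> \<open>Coordinates outside \<open>S\<close> have the default value \<open>False\<close>
    in both factors, so \<open>g\<close> and \<open>h\<close> may depend on them without
    harm.\<close>
  have dP: "f x = False" if "f \<in> set_pmf ?P" "x \<notin> ?A" for f x
    using that S set_Pi_pmf_subset[of ?A False "\<lambda>_. bernoulli_pmf p"] by blast
  have dQ: "f x = False" if "f \<in> set_pmf ?Q" "x \<notin> ?B" for f x
    using that S set_Pi_pmf_subset[of ?B False "\<lambda>_. bernoulli_pmf p"] by blast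
  have g': "g (?j (x, y)) = g x" if "x \<in> set_pmf ?P" "y \<in> set_pmf ?Q" for x y
    using dP[OF that(1)] dQ[OF that(2)] by (intro depends_onD[OF g]) auto
  have h': "h (?j (x, y)) = h y" if "x \<in> set_pmf ?P" "y \<in> set_pmf ?Q" for x y
    using dP[OF that(1)] dQ[OF that(2)] disj by (intro depends_onD[OF h]) auto
  have "measure_pmf.expectation (edge_pmf S p) (\<lambda>f. g f * h f) =
      measure_pmf.expectation (pair_pmf ?P ?Q) (\<lambda>(x, y). g x * h y)"
    unfolding un integral_map_pmf using g' h'
    by (intro integral_cong_AE) (auto simp: AE_measure_pmf_iff)
  also have "\<dots> = measure_pmf.expectation ?P g * measure_pmf.expectation ?Q h"
    using fin by (rule expectation_pair_pmf_mult)
  also have "measure_pmf.expectation ?P g = measure_pmf.expectation (edge_pmf S p) g"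
  proof -
    have "measure_pmf.expectation (edge_pmf S p) g =
        measure_pmf.expectation (pair_pmf ?P ?Q) (\<lambda>x. g (fst x))"
      unfolding un integral_map_pmf using g'
      by (intro integral_cong_AE) (auto simp: AE_measure_pmf_iff)
    then show ?thesis by simp
  qed
  also have "measure_pmf.expectation ?Q h = measure_pmf.expectation (edge_pmf S p) h"
  proof -
    have "measure_pmf.expectation (edge_pmf S p) h =
        measure_pmf.expectation (pair_pmf ?P ?Q) (\<lambda>x. h (snd x))"
      unfolding un integral_map_pmf using h'
      by (intro integral_cong_AE) (auto simp: AE_measure_pmf_iff)
    then show ?thesis by simp
  qed
  finally show ?thesis .
qed

lemma depends_on_prod:
  fixes g :: "'i \<Rightarrow> ('e \<Rightarrow> bool) \<Rightarrow> 'c::comm_monoid_mult"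
  assumes "\<And>i. i \<in> I \<Longrightarrow> depends_on (F i) (g i)"
  shows "depends_on (\<Union>i\<in>I. F i) (\<lambda>f. \<Prod>i\<in>I. g i f)"
  unfolding depends_on_def
proof (intro allI impI prod.cong refl)
  fix f f' :: "'e \<Rightarrow> bool" and i assume "\<forall>e\<in>\<Union>i\<in>I. F i. f e = f' e" "i \<in> I"
  then show "g i f = g i f'" by (intro depends_onD[OF assms]) auto
qed

lemma expectation_prod_edge_pmf:
  fixes g :: "'i \<Rightarrow> ('e \<Rightarrow> bool) \<Rightarrow> real"
  assumes "finite I" "finite S" "disjoint_family_on F I" "\<And>i. i \<in> I \<Longrightarrow> depends_on (F i) (g i)"
  shows "measure_pmf.expectation (edge_pmf S p) (\<lambda>f. \<Prod>i\<in>I. g i f) =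
    (\<Prod>i\<in>I. measure_pmf.expectation (edge_pmf S p) (g i))"
  using assms(1,3,4)
proof (induction I rule: finite_induct)
  case (insert i I)
  have "F i \<inter> F j = {}" if "j \<in> I" for j
    using insert.hyps that by (intro disjoint_family_onD[OF insert.prems(1)]) auto
  then have "F i \<inter> (\<Union>j\<in>I. F j) = {}" by blast
  then have "measure_pmf.expectation (edge_pmf S p) (\<lambda>f. g i f * (\<Prod>i\<in>I. g i f)) =
    measure_pmf.expectation (edge_pmf S p) (g i) *
    measure_pmf.expectation (edge_pmf S p) (\<lambda>f. \<Prod>i\<in>I. g i f)"
    using insert.prems(2)
    by (intro expectation_mult_edge_pmf[OF assms(2), of "F i" "\<Union>j\<in>I. F j"] depends_on_prod) auto
  also have "measure_pmf.expectation (edge_pmf S p) (\<lambda>f. \<Prod>i\<in>I. g i f) =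
      (\<Prod>i\<in>I. measure_pmf.expectation (edge_pmf S p) (g i))"
    using insert.prems by (intro insert.IH) (auto simp: disjoint_family_on_def)
  finally show ?case using insert.hyps by simp
qed simp

lemma prob_all_edge_pmf:
  fixes Q :: "'i \<Rightarrow> ('e \<Rightarrow> bool) \<Rightarrow> bool"
  assumes "finite I" "finite S" "disjoint_family_on F I" "\<And>i. i \<in> I \<Longrightarrow> depends_on (F i) (Q i)"
  shows "measure_pmf.prob (edge_pmf S p) {f. \<forall>i\<in>I. Q i f} =
    (\<Prod>i\<in>I. measure_pmf.prob (edge_pmf S p) {f. Q i f})"
proof -
  have "depends_on (F i) (indicator {f. Q i f} :: _ \<Rightarrow> real)" if "i \<in> I" for i
    unfolding depends_on_def
  proof (intro allI impI)
    fix f f' :: "'e \<Rightarrow> bool" assume "\<forall>e\<in>F i. f e = f' e"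
    then have "Q i f = Q i f'" by (intro depends_onD[OF assms(4)[OF that]]) auto
    then show "indicator {f. Q i f} f = (indicator {f. Q i f} f' :: real)" by (simp add: indicator_def)
  qed
  then have "measure_pmf.expectation (edge_pmf S p) (\<lambda>f. \<Prod>i\<in>I. indicator {f. Q i f} f) =
    (\<Prod>i\<in>I. measure_pmf.expectation (edge_pmf S p) (indicator {f. Q i f} :: _ \<Rightarrow> real))"
    by (rule expectation_prod_edge_pmf[OF assms(1-3), where g = "\<lambda>i. indicator {f. Q i f}"])
  moreover have "(\<lambda>f. \<Prod>i\<in>I. indicator {f. Q i f} f) = (indicator {f. \<forall>i\<in>I. Q i f} :: _ \<Rightarrow> real)"
    using assms(1) by (auto simp: fun_eq_iff indicator_def prod_zero_iff)
  ultimately show ?thesis by simp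
qed

lemma prob_edges_edge_pmf:
  assumes "finite S" "F \<subseteq> S" "0 \<le> p" "p \<le> 1"
  shows "measure_pmf.prob (edge_pmf S p) {f. \<forall>e\<in>F. f e} = p ^ card F"
    and "measure_pmf.prob (edge_pmf S p) {f. \<forall>e\<in>F. \<not> f e} = (1 - p) ^ card F"
proof -
  have F: "finite F" using assms finite_subset by blast
  have one: "measure_pmf.prob (edge_pmf S p) {f. f e = b} = (if b then p else 1 - p)" if "e \<in> F" for e b
  proof -
    have "measure_pmf.prob (edge_pmf S p) {f. f e = b} =
        measure_pmf.prob (map_pmf (\<lambda>f. f e) (edge_pmf S p)) {b}"
      by (simp add: vimage_def)
    also have "map_pmf (\<lambda>f. f e) (edge_pmf S p) = bernoulli_pmf p"
      using that assms by (subst Pi_pmf_component) auto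
    finally show ?thesis using assms by (simp add: measure_pmf_single)
  qed
  have "measure_pmf.prob (edge_pmf S p) {f. \<forall>e\<in>F. f e = b} =
    (\<Prod>e\<in>F. measure_pmf.prob (edge_pmf S p) {f. f e = b})" for b
    using F assms
    by (intro prob_all_edge_pmf[where F = "\<lambda>e. {e}"]) (auto simp: disjoint_family_on_def depends_on_def)
  also have "(\<Prod>e\<in>F. measure_pmf.prob (edge_pmf S p) {f. f e = b}) = (if b then p else 1 - p) ^ card F" for b
    using one by simp
  finally have *: "measure_pmf.prob (edge_pmf S p) {f. \<forall>e\<in>F. f e = b} = (if b then p else 1 - p) ^ card F" for b .
  show "measure_pmf.prob (edge_pmf S p) {f. \<forall>e\<in>F. f e} = p ^ card F" using *[of True] by simp
  show "measure_pmf.prob (edge_pmf S p) {f. \<forall>e\<in>F. \<not> f e} = (1 - p) ^ card F" using *[of False] by simp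
qed

lemma prob_ex_le:
  assumes "finite I"
  shows "measure_pmf.prob M {f. \<exists>i\<in>I. Q i f} \<le> (\<Sum>i\<in>I. measure_pmf.prob M {f. Q i f})"
proof -
  have "{f. \<exists>i\<in>I. Q i f} = (\<Union>i\<in>I. {f. Q i f})" by auto
  then show ?thesis using assms measure_pmf.finite_measure_subadditive_finite[of I "\<lambda>i. {f. Q i f}" M] by simp
qed

section \<open>The random graph\<close>

lemma finite_vertex_pairs: "finite (vertex_pairs n)"
  unfolding vertex_pairs_def by (rule finite_subset[of _ "Pow {..<n}"]) auto

lemma pair_mem_vertex_pairs: "x < n \<Longrightarrow> y < n \<Longrightarrow> x \<noteq> y \<Longrightarrow> {x, y} \<in> vertex_pairs n"
  unfolding vertex_pairs_def by simp

definition edges_of :: "nat \<Rightarrow> (nat set \<Rightarrow> bool) \<Rightarrow> nat set set" where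
  "edges_of n f = {e \<in> vertex_pairs n. f e}"

abbreviation graph_pmf :: "nat \<Rightarrow> real \<Rightarrow> (nat set \<Rightarrow> bool) pmf" where
  "graph_pmf n p \<equiv> edge_pmf (vertex_pairs n) p"

text \<open>Moves events about the graph to the product space, where independence of edges is
  available.\<close>

lemma prob_random_graph:
  "measure_pmf.prob (random_graph n p) {E. Q E} = measure_pmf.prob (graph_pmf n p) {f. Q (edges_of n f)}"
  unfolding random_graph_def edges_of_def by (simp add: vimage_def)

lemma prob_all_edges:
  assumes "S \<subseteq> {..<n}" "v < n" "v \<notin> S" "0 \<le> p" "p \<le> 1"
  shows "measure_pmf.prob (graph_pmf n p) {f. \<forall>x\<in>S. f {x, v}} = p ^ card S"
proof -
  let ?F = "(\<lambda>x. {x, v}) ` S"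
  have "inj_on (\<lambda>x. {x, v}) S" using assms(3) by (auto simp: inj_on_def doubleton_eq_iff)
  then have "card ?F = card S" by (rule card_image)
  moreover have "?F \<subseteq> vertex_pairs n" using assms by (auto intro!: pair_mem_vertex_pairs)
  moreover have "{f. \<forall>x\<in>S. f {x, v}} = {f. \<forall>e\<in>?F. f e}" by auto
  ultimately show ?thesis
    using prob_edges_edge_pmf(1)[OF finite_vertex_pairs _ assms(4,5), of ?F] by (simp only:)
qed

section \<open>Dense range: common neighbourhoods and edges between large sets\<close>

text \<open>An exponential moment bound. The product of the \<open>g v\<close> is 2 to the minus the
  number of common neighbours outside \<open>S\<close>. Its factors are independent, and there are
  at least \<open>n / 2\<close> of them. If there are fewer than \<open>m\<close> common neighbours,
  the product times \<open>2 powr m\<close> is at least 1.\<close>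

lemma prob_few_common_neighbours:
  fixes m :: real
  assumes S: "S \<subseteq> {..<n}" "card S \<le> k" and n: "2 * k \<le> n" and p: "0 \<le> p" "p \<le> 1"
  shows "measure_pmf.prob (graph_pmf n p)
      {f. card (common_neighbours n (edges_of n f) S) < m} \<le> 2 powr m * exp (- (p ^ k * n / 4))"
proof -
  let ?M = "graph_pmf n p"
  define I where "I = {..<n} - S"
  define g :: "nat \<Rightarrow> (nat set \<Rightarrow> bool) \<Rightarrow> real" where "g v f = (if \<forall>x\<in>S. f {x, v} then 1 / 2 else 1)" for v f
  have finS: "finite S" using S finite_subset by blast
  have g_exp: "measure_pmf.expectation ?M (g v) \<le> exp (- (p ^ k / 2))" if v: "v \<in> I" for v
  proof -
    have "g v = (\<lambda>f. 1 - 1 / 2 * indicator {f. \<forall>x\<in>S. f {x, v}} f)"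
      by (auto simp: g_def fun_eq_iff)
    then have "measure_pmf.expectation ?M (g v) =
        measure_pmf.expectation ?M (\<lambda>f. 1 - 1 / 2 * indicator {f. \<forall>x\<in>S. f {x, v}} f)" by (simp only:)
    also have "\<dots> = 1 - 1 / 2 * measure_pmf.prob ?M {f. \<forall>x\<in>S. f {x, v}}"
      by (subst Bochner_Integration.integral_diff) (auto intro!: integrable_edge_pmf finite_vertex_pairs)
    also have "\<dots> = 1 - p ^ card S / 2"
      using v S p by (subst prob_all_edges) (auto simp: I_def)
    \<comment> \<open>\<open>S\<close> may have fewer than \<open>k\<close> elements, as a tuple can
      repeat vertices; then \<open>p ^ card S\<close> is at least \<open>p ^ k\<close>.\<close>
    also have "\<dots> \<le> 1 - p ^ k / 2" using power_decreasing[OF S(2) p] by simp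
    also have "\<dots> \<le> exp (- (p ^ k / 2))" using exp_ge_add_one_self[of "- (p ^ k / 2)"] by simp
    finally show ?thesis .
  qed
  have g_nonneg: "0 \<le> measure_pmf.expectation ?M (g v)" for v
    by (intro Bochner_Integration.integral_nonneg) (simp add: g_def)
  have "measure_pmf.expectation ?M (\<lambda>f. \<Prod>v\<in>I. g v f) = (\<Prod>v\<in>I. measure_pmf.expectation ?M (g v))"
  proof (rule expectation_prod_edge_pmf[OF _ finite_vertex_pairs])
    show "finite I" by (simp add: I_def)
    \<comment> \<open>As \<open>v\<close> lies outside \<open>S\<close>, it can be read off from the
      pair \<open>{x, v}\<close>.\<close>
    show "disjoint_family_on (\<lambda>v. (\<lambda>x. {x, v}) ` S) I"
      unfolding disjoint_family_on_def I_def by (auto simp: doubleton_eq_iff)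
    show "depends_on ((\<lambda>x. {x, v}) ` S) (g v)" for v
      unfolding depends_on_def g_def by simp
  qed
  also have "\<dots> \<le> (\<Prod>v\<in>I. exp (- (p ^ k / 2)))"
    using g_exp g_nonneg by (intro prod_mono) auto
  also have "\<dots> = exp (- (p ^ k / 2) * card I)" by (simp add: exp_of_nat2_mult[symmetric])
  also have "\<dots> \<le> exp (- (p ^ k * n / 4))"
  proof -
    have "card I = n - card S" using S finS by (simp add: I_def card_Diff_subset)
    then have "real n / 2 \<le> card I" using S(2) n by linarith
    then have "p ^ k / 2 * (real n / 2) \<le> p ^ k / 2 * card I" using p by (intro mult_left_mono) auto
    then show ?thesis by simp
  qed
  finally have E: "measure_pmf.expectation ?M (\<lambda>f. \<Prod>v\<in>I. g v f) \<le> exp (- (p ^ k * n / 4))" .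
  let ?B = "{f. card (common_neighbours n (edges_of n f) S) < m}"
  have "indicator ?B f \<le> 2 powr m * (\<Prod>v\<in>I. g v f)" for f
  proof (cases "f \<in> ?B")
    case True
    let ?N = "{v \<in> I. \<forall>x\<in>S. f {x, v}}"
    have "?N \<subseteq> common_neighbours n (edges_of n f) S"
      using S unfolding common_neighbours_def edges_of_def I_def by (auto intro!: pair_mem_vertex_pairs)
    then have "card ?N \<le> card (common_neighbours n (edges_of n f) S)"
      by (intro card_mono) (auto simp: common_neighbours_def)
    then have "card ?N \<le> m" using True by simp
    then have "2 powr real (card ?N) \<le> 2 powr m" by (intro powr_mono) auto
    then have "2 ^ card ?N * (1 / 2) ^ card ?N \<le> 2 powr m * (1 / 2) ^ card ?N"
      by (intro mult_right_mono) (simp_all add: powr_realpow)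
    moreover have "(2 :: real) ^ card ?N * (1 / 2) ^ card ?N = 1"
      by (simp only: power_mult_distrib[symmetric]) simp
    ultimately have "1 \<le> 2 powr m * (1 / 2) ^ card ?N" by (simp only:)
    also have "(1 / 2 :: real) ^ card ?N = (\<Prod>v\<in>I. g v f)"
    proof -
      have "(1 / 2 :: real) ^ card ?N = (\<Prod>v\<in>?N. 1 / 2)" by (simp only: prod_constant)
      also have "\<dots> = (\<Prod>v\<in>I. if \<forall>x\<in>S. f {x, v} then 1 / 2 else 1)"
        by (rule prod.inter_filter) (simp add: I_def)
      finally show ?thesis unfolding g_def .
    qed
    finally show ?thesis using True by simp
  next
    case False
    have "0 \<le> (\<Prod>v\<in>I. g v f)" by (intro prod_nonneg) (simp add: g_def)
    then show ?thesis using False by simp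
  qed
  then have "measure_pmf.expectation ?M (indicator ?B) \<le> measure_pmf.expectation ?M (\<lambda>f. 2 powr m * (\<Prod>v\<in>I. g v f))"
    by (intro integral_mono integrable_edge_pmf finite_vertex_pairs)
  then show ?thesis using E by (simp add: order_trans mult_left_mono)
qed

lemma prob_no_edge_between:
  assumes "X \<subseteq> {..<n}" "Y \<subseteq> {..<n}" "X \<inter> Y = {}" "0 \<le> p" "p \<le> 1"
  shows "measure_pmf.prob (graph_pmf n p) {f. \<forall>x\<in>X. \<forall>y\<in>Y. {x, y} \<notin> edges_of n f} =
    (1 - p) ^ (card X * card Y)"
proof -
  let ?F = "(\<lambda>(x, y). {x, y}) ` (X \<times> Y)"
  have "inj_on (\<lambda>(x, y). {x, y}) (X \<times> Y)" using assms(3) by (auto simp: inj_on_def doubleton_eq_iff)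
  then have "card ?F = card X * card Y" by (simp only: card_image card_cartesian_product)
  moreover have sub: "?F \<subseteq> vertex_pairs n" using assms(1-3) by (auto intro!: pair_mem_vertex_pairs)
  moreover have "{f. \<forall>x\<in>X. \<forall>y\<in>Y. {x, y} \<notin> edges_of n f} = {f. \<forall>e\<in>?F. \<not> f e}"
    using sub unfolding edges_of_def by auto
  ultimately show ?thesis
    using prob_edges_edge_pmf(2)[OF finite_vertex_pairs sub assms(4,5)] by simp
qed

text \<open>Union bound: there are at most \<open>n ^ (2 * s)\<close> pairs of sets, and each pair
  has \<open>s * s\<close> potential edges, all absent.\<close>

lemma prob_bipartite_hole_le:
  assumes p: "0 \<le> p" "p \<le> 1"
  shows "measure_pmf.prob (graph_pmf n p)
    {f. \<exists>X Y. X \<subseteq> {..<n} \<and> Y \<subseteq> {..<n} \<and> X \<inter> Y = {} \<and> card X = s \<and> card Y = s \<and>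
      (\<forall>x\<in>X. \<forall>y\<in>Y. {x, y} \<notin> edges_of n f)} \<le> real n ^ (2 * s) * exp (- p * (real s)\<^sup>2)"
    (is "measure_pmf.prob ?M ?B \<le> _")
proof -
  let ?S = "{X. X \<subseteq> {..<n} \<and> card X = s}"
  let ?I = "{(X, Y). X \<in> ?S \<and> Y \<in> ?S \<and> X \<inter> Y = {}}"
  have finS: "finite ?S" by (rule finite_subset[of _ "Pow {..<n}"]) auto
  have sub: "?I \<subseteq> ?S \<times> ?S" by auto
  have fin: "finite ?I" using finite_subset[OF sub] finS by blast
  have "card ?S = n choose s" using n_subsets[of "{..<n}" s] by simp
  also have "\<dots> \<le> n ^ s" by (cases "s \<le> n") (auto intro: binomial_le_pow simp: binomial_eq_0)
  finally have "card ?S * card ?S \<le> n ^ s * n ^ s" by (intro mult_le_mono)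
  then have "card ?I \<le> n ^ (2 * s)"
    using card_mono[OF _ sub] finS by (simp add: card_cartesian_product power_add[symmetric] mult_2)
  then have cardI: "real (card ?I) \<le> real n ^ (2 * s)" by (simp only: of_nat_power[symmetric] of_nat_le_iff)
  let ?Q = "\<lambda>i f. \<forall>x\<in>fst i. \<forall>y\<in>snd i. {x, y} \<notin> edges_of n f"
  have "?B \<subseteq> {f. \<exists>i\<in>?I. ?Q i f}"
  proof
    fix f assume "f \<in> ?B"
    then obtain X Y where "(X, Y) \<in> ?I" "?Q (X, Y) f" by auto
    then show "f \<in> {f. \<exists>i\<in>?I. ?Q i f}" by blast
  qed
  then have "measure_pmf.prob ?M ?B \<le> measure_pmf.prob ?M {f. \<exists>i\<in>?I. ?Q i f}"
    by (intro measure_pmf.finite_measure_mono) auto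
  also have "\<dots> \<le> (\<Sum>i\<in>?I. measure_pmf.prob ?M {f. ?Q i f})"
    by (rule prob_ex_le[OF fin])
  also have "\<dots> \<le> (\<Sum>i\<in>?I. exp (- p * (real s)\<^sup>2))"
  proof (intro sum_mono)
    fix i assume i: "i \<in> ?I"
    then have "measure_pmf.prob ?M {f. ?Q i f} = (1 - p) ^ (s * s)"
      using prob_no_edge_between[of "fst i" n "snd i" p] p by auto
    also have "\<dots> \<le> exp (- p) ^ (s * s)"
      using p exp_ge_add_one_self[of "- p"] by (intro power_mono) auto
    also have "\<dots> = exp (- p * (real s)\<^sup>2)" by (simp add: exp_of_nat2_mult[symmetric] power2_eq_square)
    finally show "measure_pmf.prob ?M {f. ?Q i f} \<le> exp (- p * (real s)\<^sup>2)" .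
  qed
  also have "\<dots> = real (card ?I) * exp (- p * (real s)\<^sup>2)" by simp
  also have "\<dots> \<le> real n ^ (2 * s) * exp (- p * (real s)\<^sup>2)" using cardI by (intro mult_right_mono) auto
  finally show ?thesis .
qed

text \<open>Two bad events, each of probability at most \<open>1 / n\<close>: a tuple with fewer
  than \<open>m\<close> common neighbours, and a pair of disjoint \<open>s\<close>-sets with no edge
  between them. Here \<open>s\<close> is the size to which sets of size \<open>m\<close> may shrink,
  after losing the factor \<open>K\<close>.\<close>

lemma prob_tc_gt_le:
  fixes K r k n :: nat and p :: real
  defines "K \<equiv> (2 * 4 ^ r) ^ r * 4 ^ r"
  assumes r: "r > 0" and p: "0 \<le> p" "p \<le> 1" and n: "2 * k \<le> n" "n \<ge> 2"
    and kc: "\<And>(V :: nat set) H. partite_hypergraph r V H \<Longrightarrow> intersecting_covers k H \<Longrightarrow> cover_number V H \<le> t"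
    and dense: "24 * real K * real (k + 1) * ln (real n) \<le> p ^ (k + 1) * real n"
  shows "measure_pmf.prob (graph_pmf n p) {f. \<not> tc r {..<n} (edges_of n f) \<le> t} \<le> 2 / real n"
proof -
  let ?M = "graph_pmf n p"
  define m where "m = p ^ k * n / 8"
  define s where "s = nat \<lceil>m / K\<rceil>"
  have "0 < K" unfolding K_def by (intro mult_pos_pos zero_less_power) auto
  then have K: "K \<ge> 1" by simp
  have ln: "ln n > 0" using n by simp
  have "0 < 24 * real K * real (k + 1) * ln n" using K ln by (intro mult_pos_pos) auto
  then have "p ^ (k + 1) * n > 0" using dense by linarith
  then have p0: "p > 0" using p by (cases "p = 0") auto
  then have m: "m > 0" unfolding m_def using n by simp
  have sm: "m / K \<le> s" unfolding s_def by linarith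
  have "0 < m / K" using m K by simp
  then have s1: "s \<ge> 1" using sm by (cases s) auto
  \<comment> \<open>The factor 24 is 3 times 8, where 8 comes from \<open>m\<close>. Of the 3, a
    part 2 beats the count \<open>n ^ (2 * s)\<close> and the remaining 1 gives the error
    \<open>1 / n\<close>.\<close>
  have ps: "3 * ln n \<le> p * s"
  proof -
    have "24 * real K * 1 * ln n \<le> 24 * real K * real (k + 1) * ln n"
      using ln by (intro mult_right_mono mult_left_mono) auto
    also have "\<dots> \<le> p ^ (k + 1) * real n" by (rule dense)
    finally have "24 * real K * ln n \<le> p ^ (k + 1) * real n" by (simp only: mult_1_right)
    then have "3 * ln n \<le> p ^ (k + 1) * n / (8 * K)" using K by (simp add: field_simps)
    also have "\<dots> = p * (m / K)" unfolding m_def by simp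
    also have "\<dots> \<le> p * s" using sm p by (intro mult_left_mono)
    finally show ?thesis .
  qed
  \<comment> \<open>The \<open>k\<close> pays for the \<open>n ^ k\<close> tuples and the extra 1
    again leaves \<open>1 / n\<close>.\<close>
  have pk: "(real k + 1) * ln n \<le> p ^ k * n / 8"
  proof -
    have "8 * 1 * real (k + 1) * ln n \<le> 24 * real K * real (k + 1) * ln n" using ln K by (intro mult_right_mono mult_mono) auto
    also have "\<dots> \<le> p ^ (k + 1) * n" by (rule dense)
    also have "\<dots> \<le> p ^ k * n" using p by (intro mult_right_mono power_decreasing) auto
    finally show ?thesis by (simp add: algebra_simps)
  qed
  let ?B1 = "{f. \<exists>xs\<in>{xs. set xs \<subseteq> {..<n} \<and> length xs = k}.
      card (common_neighbours n (edges_of n f) (set xs)) < m}"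
  let ?B2 = "{f. \<exists>X Y. X \<subseteq> {..<n} \<and> Y \<subseteq> {..<n} \<and> X \<inter> Y = {} \<and> card X = s \<and> card Y = s \<and>
      (\<forall>x\<in>X. \<forall>y\<in>Y. {x, y} \<notin> edges_of n f)}"
  have "measure_pmf.prob ?M ?B1 \<le> (\<Sum>xs\<in>{xs. set xs \<subseteq> {..<n} \<and> length xs = k}.
      measure_pmf.prob ?M {f. card (common_neighbours n (edges_of n f) (set xs)) < m})"
    by (intro prob_ex_le finite_lists_length_eq) simp
  also have "\<dots> \<le> (\<Sum>xs\<in>{xs :: nat list. set xs \<subseteq> {..<n} \<and> length xs = k}. exp (- ((real k + 1) * ln n)))"
  proof (intro sum_mono)
    fix xs assume "xs \<in> {xs. set xs \<subseteq> {..<n} \<and> length xs = k}"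
    then have "set xs \<subseteq> {..<n}" "card (set xs) \<le> k" using card_length[of xs] by auto
    then have "measure_pmf.prob ?M {f. card (common_neighbours n (edges_of n f) (set xs)) < m} \<le>
        2 powr m * exp (- (p ^ k * n / 4))"
      using n p by (intro prob_few_common_neighbours)
    \<comment> \<open>Since \<open>ln 2 < 1\<close>, the loss \<open>2 powr m\<close> is at most
      \<open>exp m\<close>, which uses up only half of the exponent \<open>2 * m\<close>.\<close>
    also have "\<dots> \<le> exp m * exp (- (p ^ k * n / 4))"
      unfolding powr_def using m ln_2_less_1 by (intro mult_right_mono) auto
    also have "exp m * exp (- (p ^ k * n / 4)) = exp (- (p ^ k * n / 8))"
      by (simp add: m_def exp_add[symmetric])
    also have "\<dots> \<le> exp (- ((real k + 1) * ln n))" using pk by simp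
    finally show "measure_pmf.prob ?M {f. card (common_neighbours n (edges_of n f) (set xs)) < m} \<le> exp (- ((real k + 1) * ln n))"
      by simp
  qed
  also have "\<dots> = n ^ k * exp (- ((real k + 1) * ln n))" using card_lists_length_eq[of "{..<n}" k] by simp
  also have "real (n ^ k) = exp (k * ln n)" using n by (simp add: exp_of_nat_mult)
  also have "exp (k * ln n) * exp (- ((real k + 1) * ln n)) = 1 / n"
    using n by (simp add: exp_add[symmetric] algebra_simps exp_minus inverse_eq_divide)
  finally have B1: "measure_pmf.prob ?M ?B1 \<le> 1 / n" by simp
  have "measure_pmf.prob ?M ?B2 \<le> real n ^ (2 * s) * exp (- p * (real s)\<^sup>2)"
    using p by (rule prob_bipartite_hole_le)
  also have "real n ^ (2 * s) = exp (2 * s * ln n)" using n exp_of_nat_mult[of "2 * s" "ln n"] by simp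
  also have "exp (2 * s * ln n) * exp (- p * (real s)\<^sup>2) \<le> exp (- ln n)"
  proof -
    have "s * (3 * ln n) \<le> s * (p * s)" using ps by (intro mult_left_mono) auto
    moreover have "1 * ln n \<le> s * ln n" using s1 ln by (intro mult_right_mono) auto
    ultimately show ?thesis by (simp add: exp_add[symmetric] power2_eq_square algebra_simps)
  qed
  also have "exp (- ln n) = 1 / n" using n by (simp add: exp_minus inverse_eq_divide)
  finally have B2: "measure_pmf.prob ?M ?B2 \<le> 1 / n" .
  have tc: "tc r {..<n} (edges_of n f) \<le> t" if f: "f \<notin> ?B1" "f \<notin> ?B2" for f
  proof (rule tc_le_if_covers_intersecting[OF r m kc])
    show "m \<le> card (common_neighbours n (edges_of n f) (set xs))" if "length xs = k" "set xs \<subseteq> {..<n}" for xs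
      using f(1) that by (auto simp: not_less)
    fix X Y :: "nat set" assume XY: "X \<subseteq> {..<n}" "Y \<subseteq> {..<n}" "X \<inter> Y = {}"
      "m \<le> real ((2 * 4 ^ r) ^ r * 4 ^ r * card X)" "m \<le> real ((2 * 4 ^ r) ^ r * 4 ^ r * card Y)"
    have "s \<le> card Z" if "m \<le> real (K * card Z)" for Z :: "nat set"
      using that K unfolding s_def by (simp add: nat_le_iff ceiling_le_iff field_simps)
    then have "s \<le> card X" "s \<le> card Y" using XY unfolding K_def by blast+
    then obtain X' Y' where X'Y': "X' \<subseteq> X" "card X' = s" "Y' \<subseteq> Y" "card Y' = s"
      by (meson obtain_subset_with_card_n)
    have "X' \<subseteq> {..<n}" "Y' \<subseteq> {..<n}" "X' \<inter> Y' = {}" using XY X'Y' by blast+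
    then have inB2: "f \<in> ?B2" if "\<forall>x\<in>X'. \<forall>y\<in>Y'. {x, y} \<notin> edges_of n f"
      using that X'Y' by (intro CollectI exI[of _ X'] exI[of _ Y'] conjI)
    from f(2) have "\<not> (\<forall>x\<in>X'. \<forall>y\<in>Y'. {x, y} \<notin> edges_of n f)"
      by (rule contrapos_nn) (rule inB2)
    then have "\<exists>x\<in>X'. \<exists>y\<in>Y'. {x, y} \<in> edges_of n f" by simp
    then show "\<exists>x\<in>X. \<exists>y\<in>Y. {x, y} \<in> edges_of n f" using X'Y' by blast
  qed
  have "{f. \<not> tc r {..<n} (edges_of n f) \<le> t} \<subseteq> ?B1 \<union> ?B2"
  proof (intro subsetI UnCI)
    fix f assume "f \<in> {f. \<not> tc r {..<n} (edges_of n f) \<le> t}" and f: "f \<notin> ?B2"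
    then have "\<not> tc r {..<n} (edges_of n f) \<le> t" by simp
    then show "f \<in> ?B1" using tc[OF _ f] by (rule contrapos_np)
  qed
  then have "measure_pmf.prob ?M {f. \<not> tc r {..<n} (edges_of n f) \<le> t} \<le> measure_pmf.prob ?M (?B1 \<union> ?B2)"
    by (intro measure_pmf.finite_measure_mono) auto
  also have "\<dots> \<le> measure_pmf.prob ?M ?B1 + measure_pmf.prob ?M ?B2"
    by (rule measure_Un_le) auto
  also have "\<dots> \<le> 2 / n" using B1 B2 by simp
  finally show ?thesis .
qed

section \<open>Sparse range: edges inside the blocks and good blocks\<close>

lemma prob_edge_inside_le:
  assumes "0 \<le> p" "p \<le> 1"
  shows "measure_pmf.prob (graph_pmf n p) {f. \<exists>x<N. \<exists>y<N. {x, y} \<in> edges_of n f} \<le> (real N)\<^sup>2 * p"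
proof -
  let ?M = "graph_pmf n p" and ?I = "{..<N} \<times> {..<N}"
  have "{f. \<exists>x<N. \<exists>y<N. {x, y} \<in> edges_of n f} = {f. \<exists>i\<in>?I. {fst i, snd i} \<in> edges_of n f}"
    by auto
  then have "measure_pmf.prob ?M {f. \<exists>x<N. \<exists>y<N. {x, y} \<in> edges_of n f} \<le>
      (\<Sum>i\<in>?I. measure_pmf.prob ?M {f. {fst i, snd i} \<in> edges_of n f})"
    using prob_ex_le[of ?I ?M "\<lambda>i f. {fst i, snd i} \<in> edges_of n f"] by simp
  also have "\<dots> \<le> (\<Sum>i\<in>?I. p)"
  proof (rule sum_mono)
    fix i
    show "measure_pmf.prob ?M {f. {fst i, snd i} \<in> edges_of n f} \<le> p"
    proof (cases "{fst i, snd i} \<in> vertex_pairs n")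
      case True
      then have "measure_pmf.prob ?M {f. \<forall>e\<in>{{fst i, snd i}}. f e} = p ^ card {{fst i, snd i}}"
        using assms by (intro prob_edges_edge_pmf(1) finite_vertex_pairs) auto
      then show ?thesis using True by (simp add: edges_of_def)
    next
      case False
      then show ?thesis using assms by (simp add: edges_of_def)
    qed
  qed
  also have "\<dots> = (real N)\<^sup>2 * p" by (simp add: power2_eq_square)
  finally show ?thesis .
qed

text \<open>Union bound over the \<open>k\<close>-subsets of \<open>U\<close>. The crude count
  \<open>2 ^ card U\<close> suffices because blocks will have bounded size.\<close>

lemma prob_many_neighbours_le:
  assumes U: "U \<subseteq> {..<n}" and w: "w < n" "w \<notin> U" and p: "0 \<le> p" "p \<le> 1"
  shows "measure_pmf.prob (graph_pmf n p) {f. k \<le> card {x \<in> U. f {x, w}}} \<le> 2 ^ card U * p ^ k"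
proof -
  let ?M = "graph_pmf n p" and ?I = "{A. A \<subseteq> U \<and> card A = k}"
  have finU: "finite U" using U finite_subset by blast
  have finI: "finite ?I" by (rule finite_subset[of _ "Pow U"]) (use finU in auto)
  have "{f. k \<le> card {x \<in> U. f {x, w}}} \<subseteq> {f. \<exists>A\<in>?I. \<forall>x\<in>A. f {x, w}}"
  proof
    fix f assume "f \<in> {f. k \<le> card {x \<in> U. f {x, w}}}"
    then obtain A where "A \<subseteq> {x \<in> U. f {x, w}}" "card A = k"
      using obtain_subset_with_card_n by blast
    then show "f \<in> {f. \<exists>A\<in>?I. \<forall>x\<in>A. f {x, w}}" by blast
  qed
  then have "measure_pmf.prob ?M {f. k \<le> card {x \<in> U. f {x, w}}} \<le>
      measure_pmf.prob ?M {f. \<exists>A\<in>?I. \<forall>x\<in>A. f {x, w}}"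
    by (intro measure_pmf.finite_measure_mono) auto
  also have "\<dots> \<le> (\<Sum>A\<in>?I. measure_pmf.prob ?M {f. \<forall>x\<in>A. f {x, w}})"
    by (rule prob_ex_le[OF finI])
  also have "\<dots> = (\<Sum>A\<in>?I. p ^ k)"
  proof (rule sum.cong[OF refl])
    fix A assume A: "A \<in> ?I"
    then have "measure_pmf.prob ?M {f. \<forall>x\<in>A. f {x, w}} = p ^ card A"
      using U w p by (intro prob_all_edges) auto
    then show "measure_pmf.prob ?M {f. \<forall>x\<in>A. f {x, w}} = p ^ k" using A by simp
  qed
  also have "\<dots> = real (card ?I) * p ^ k" by simp
  also have "\<dots> \<le> 2 ^ card U * p ^ k"
  proof -
    have "card ?I \<le> card (Pow U)" using finU by (intro card_mono) auto
    then have "card ?I \<le> 2 ^ card U" using finU by (simp add: card_Pow)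
    then have "real (card ?I) \<le> real (2 ^ card U)" by (simp only: of_nat_le_iff)
    then show ?thesis using p by (intro mult_right_mono) auto
  qed
  finally show ?thesis .
qed

text \<open>Independence is used twice: within a block the outside vertices \<open>w\<close> use
  disjoint sets of pairs, and different blocks do so as well. Hence each block is good with
  probability at least \<open>(1 - 2 ^ M * p ^ k) ^ n\<close>, and the failures of the
  \<open>l\<close> blocks multiply.\<close>

lemma prob_no_good_block_le:
  fixes U :: "nat \<Rightarrow> nat set"
  assumes U: "\<And>j. j < l \<Longrightarrow> U j \<subseteq> {..<n} \<and> card (U j) = M" and disj: "disjoint_family_on U {..<l}"
    and W: "W \<subseteq> {..<n}" and UW: "\<And>j. j < l \<Longrightarrow> U j \<inter> W = {}" and p: "0 \<le> p" "p \<le> 1"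
    and q: "2 ^ M * p ^ k \<le> 1"
  shows "measure_pmf.prob (graph_pmf n p)
      {f. \<forall>j<l. \<exists>w\<in>W. k \<le> card {x \<in> U j. f {x, w}}} \<le> (1 - (1 - 2 ^ M * p ^ k) ^ n) ^ l"
proof -
  let ?M = "graph_pmf n p"
  let ?many = "\<lambda>j w f. k \<le> card {x \<in> U j. f {x, w}}"
  let ?F = "\<lambda>j w. (\<lambda>x. {x, w}) ` U j"
  have finW: "finite W" using W finite_subset by blast
  have dep: "depends_on (?F j w) (\<lambda>f. ?many j w f)" for j w
    unfolding depends_on_def
  proof (intro allI impI)
    fix f f' :: "nat set \<Rightarrow> bool" assume "\<forall>e\<in>?F j w. f e = f' e"
    then have "{x \<in> U j. f {x, w}} = {x \<in> U j. f' {x, w}}" by auto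
    then show "?many j w f = ?many j w f'" by (simp only:)
  qed
  have block: "measure_pmf.prob ?M {f. \<exists>w\<in>W. ?many j w f} \<le> 1 - (1 - 2 ^ M * p ^ k) ^ n"
    if j: "j < l" for j
  proof -
    \<comment> \<open>By \<open>q\<close> the base lies between 0 and 1, so the exponent
      \<open>card W\<close> may be raised to \<open>n\<close>.\<close>
    have "(1 - 2 ^ M * p ^ k) ^ n \<le> (1 - 2 ^ M * p ^ k) ^ card W"
      using q p card_mono[OF _ W] by (intro power_decreasing) auto
    also have "\<dots> = (\<Prod>w\<in>W. 1 - 2 ^ M * p ^ k)" by simp
    also have "\<dots> \<le> (\<Prod>w\<in>W. measure_pmf.prob ?M {f. \<not> ?many j w f})"
    proof (rule prod_mono, intro conjI)
      fix w assume w: "w \<in> W"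
      have "measure_pmf.prob ?M {f. ?many j w f} \<le> 2 ^ card (U j) * p ^ k"
        using U[OF j] UW[OF j] w W p by (intro prob_many_neighbours_le) auto
      moreover have "measure_pmf.prob ?M {f. \<not> ?many j w f} = 1 - measure_pmf.prob ?M {f. ?many j w f}"
        by (subst measure_pmf.prob_compl[symmetric]) (auto intro!: arg_cong[where f = "measure_pmf.prob ?M"])
      ultimately show "1 - 2 ^ M * p ^ k \<le> measure_pmf.prob ?M {f. \<not> ?many j w f}"
        using U[OF j] by simp
    qed (use q in simp)
    also have "\<dots> = measure_pmf.prob ?M {f. \<forall>w\<in>W. \<not> ?many j w f}"
    proof (rule prob_all_edge_pmf[symmetric, OF finW finite_vertex_pairs])
      show "disjoint_family_on (?F j) W"
        using UW[OF j] unfolding disjoint_family_on_def by (auto simp: doubleton_eq_iff)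
      show "depends_on (?F j w) (\<lambda>f. \<not> ?many j w f)" for w
        using dep[of w j] unfolding depends_on_def by simp
    qed
    also have "\<dots> = 1 - measure_pmf.prob ?M {f. \<exists>w\<in>W. ?many j w f}"
      by (subst measure_pmf.prob_compl[symmetric]) (auto intro!: arg_cong[where f = "measure_pmf.prob ?M"])
    finally show ?thesis by simp
  qed
  have "measure_pmf.prob ?M {f. \<forall>j\<in>{..<l}. \<exists>w\<in>W. ?many j w f} =
      (\<Prod>j\<in>{..<l}. measure_pmf.prob ?M {f. \<exists>w\<in>W. ?many j w f})"
  proof (rule prob_all_edge_pmf[OF _ finite_vertex_pairs])
    show "disjoint_family_on (\<lambda>j. \<Union>w\<in>W. ?F j w) {..<l}"
      unfolding disjoint_family_on_def
    proof (intro ballI impI)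
      fix i j assume ij: "i \<in> {..<l}" "j \<in> {..<l}" "i \<noteq> j"
      \<comment> \<open>A pair has one end in a block and the other in \<open>W\<close>, which meets
        no block, so it determines its block.\<close>
      then have "U i \<inter> U j = {}" using disj unfolding disjoint_family_on_def by blast
      then show "(\<Union>w\<in>W. ?F i w) \<inter> (\<Union>w\<in>W. ?F j w) = {}"
        using UW[of i] UW[of j] ij by (auto simp: doubleton_eq_iff)
    qed
    show "depends_on (\<Union>w\<in>W. ?F j w) (\<lambda>f. \<exists>w\<in>W. ?many j w f)" for j
      unfolding depends_on_def
    proof (intro allI impI)
      fix f f' :: "nat set \<Rightarrow> bool" assume eq: "\<forall>e\<in>\<Union>w\<in>W. ?F j w. f e = f' e"
      have "?many j w f = ?many j w f'" if "w \<in> W" for w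
        using that eq by (intro depends_onD[OF dep]) blast
      then show "(\<exists>w\<in>W. ?many j w f) = (\<exists>w\<in>W. ?many j w f')" by (intro bex_cong refl)
    qed
  qed simp
  also have "\<dots> \<le> (\<Prod>j\<in>{..<l}. 1 - (1 - 2 ^ M * p ^ k) ^ n)"
    using block by (intro prod_mono) auto
  finally show ?thesis by (simp only: Ball_def lessThan_iff prod_constant card_lessThan)
qed

text \<open>The blocks are consecutive intervals filling the first \<open>l * card H\<close>
  vertices. Off the two bad events the reserved vertices span no edge and some block is good, so
  \<open>H\<close> can be placed on that block.\<close>

lemma prob_tc_le_le:
  assumes r: "r > 0" and part: "partite_hypergraph r V H" and cov: "intersecting_covers (k - 1) H"
    and cn: "cover_number V H > t" and k: "k > 0" and H: "H \<noteq> {}" "finite H"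
    and p: "0 \<le> p" "p \<le> 1" and l: "l * card H \<le> n" and q: "2 ^ card H * p ^ k \<le> 1"
  shows "measure_pmf.prob (graph_pmf n p) {f. \<not> tc r {..<n} (edges_of n f) > t} \<le>
    (real (l * card H))\<^sup>2 * p + (1 - (1 - 2 ^ card H * p ^ k) ^ n) ^ l"
proof -
  let ?M = "graph_pmf n p"
  define M where "M = card H"
  define U where "U j = {j * M..<j * M + M}" for j
  obtain g where g: "bij_betw g H {0..<M}"
    using ex_bij_betw_finite_nat[OF H(2)] unfolding M_def by blast
  have Usub: "U j \<subseteq> {..<l * M}" if "j < l" for j
  proof -
    have "(j + 1) * M \<le> l * M" using that by (intro mult_le_mono1) simp
    then show ?thesis unfolding U_def by auto
  qed
  have disj: "disjoint_family_on U {..<l}"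
    unfolding disjoint_family_on_def
  proof (intro ballI impI)
    have "U i \<inter> U j = {}" if "i < j" for i j
    proof -
      have "(i + 1) * M \<le> j * M" using that by (intro mult_le_mono1) simp
      then show ?thesis unfolding U_def by auto
    qed
    then show "U i \<inter> U j = {}" if "i \<noteq> j" for i j using that by (metis Int_commute nat_neq_iff)
  qed
  let ?B1 = "{f. \<exists>x<l * M. \<exists>y<l * M. {x, y} \<in> edges_of n f}"
  let ?B2 = "{f. \<forall>j<l. \<exists>w\<in>{l * M..<n}. k \<le> card {x \<in> U j. f {x, w}}}"
  have B1: "measure_pmf.prob ?M ?B1 \<le> (real (l * M))\<^sup>2 * p" using p by (rule prob_edge_inside_le)
  have B2: "measure_pmf.prob ?M ?B2 \<le> (1 - (1 - 2 ^ M * p ^ k) ^ n) ^ l"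
  proof (rule prob_no_good_block_le[OF _ disj _ _ p])
    show "U j \<subseteq> {..<n} \<and> card (U j) = M" if "j < l" for j
      using Usub[OF that] l unfolding M_def[symmetric] by (auto simp: U_def)
    show "U j \<inter> {l * M..<n} = {}" if "j < l" for j using Usub[OF that] by auto
    show "2 ^ M * p ^ k \<le> 1" using q unfolding M_def .
  qed auto
  have "tc r {..<n} (edges_of n f) > t" if f: "f \<notin> ?B1" "f \<notin> ?B2" for f
  proof -
    obtain j where j: "j < l" "\<And>w. w \<in> {l * M..<n} \<Longrightarrow> card {x \<in> U j. f {x, w}} < k"
      using f(2) by (auto simp: not_le)
    define u where "u e = j * M + g e" for e
    have uH: "u ` H = U j"
    proof -
      have "u ` H = (+) (j * M) ` g ` H" unfolding u_def by auto
      also have "g ` H = {0..<M}" using g by (rule bij_betw_imp_surj_on)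
      also have "(+) (j * M) ` {0..<M} = U j"
        unfolding U_def image_add_atLeastLessThan by (simp add: add.commute)
      finally show ?thesis .
    qed
    have noedge: "{x, y} \<notin> edges_of n f" if "x < l * M" "y < l * M" for x y using f(1) that by blast
    show ?thesis
    proof (rule tc_gt_if_independent_embedding[OF r part cov cn H(1), where u = u])
      show "edges_of n f \<subseteq> vertex_pairs n" unfolding edges_of_def by blast
      show "inj_on u H" using bij_betw_imp_inj_on[OF g] unfolding u_def inj_on_def by simp
      have "U j \<subseteq> {..<l * M}" by (rule Usub[OF j(1)])
      then show "u ` H \<subseteq> {..<n}" unfolding uH using l unfolding M_def[symmetric] by auto
      show "{x, y} \<notin> edges_of n f" if "x \<in> u ` H" "y \<in> u ` H" for x y
        using that Usub[OF j(1)] unfolding uH by (intro noedge) auto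
      fix w assume w: "w < n" "w \<notin> u ` H"
      show "card {x \<in> u ` H. {w, x} \<in> edges_of n f} \<le> k - 1"
      \<comment> \<open>Reserved vertices outside the block have no neighbour in it; for the others,
        fewer than \<open>k\<close> means at most \<open>k - 1\<close>.\<close>
      proof (cases "w < l * M")
        case True
        have "x < l * M" if "x \<in> U j" for x using Usub[OF j(1)] that by auto
        then have "{x \<in> u ` H. {w, x} \<in> edges_of n f} = {}" unfolding uH using noedge[OF True] by blast
        then show ?thesis by (simp only: card.empty)
      next
        case False
        have "card {x \<in> u ` H. {w, x} \<in> edges_of n f} \<le> card {x \<in> U j. f {x, w}}"
          unfolding uH by (intro card_mono) (auto simp: U_def edges_of_def insert_commute)
        also have "\<dots> < k" using False w by (intro j(2)) auto
        finally show ?thesis by simp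
      qed
    qed
  qed
  then have "{f. \<not> tc r {..<n} (edges_of n f) > t} \<subseteq> ?B1 \<union> ?B2" by blast
  then have "measure_pmf.prob ?M {f. \<not> tc r {..<n} (edges_of n f) > t} \<le> measure_pmf.prob ?M (?B1 \<union> ?B2)"
    by (intro measure_pmf.finite_measure_mono) auto
  also have "\<dots> \<le> measure_pmf.prob ?M ?B1 + measure_pmf.prob ?M ?B2"
    by (rule measure_Un_le) auto
  also have "\<dots> \<le> (real (l * M))\<^sup>2 * p + (1 - (1 - 2 ^ M * p ^ k) ^ n) ^ l" using B1 B2 by simp
  finally show ?thesis unfolding M_def .
qed

section \<open>Passage to the limit and choice of constants\<close>

lemma whpI:
  assumes "\<forall>\<^sub>F n in sequentially. measure_pmf.prob (graph_pmf n (p n)) {f. \<not> Q n (edges_of n f)} \<le> err n"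
    and "err \<longlonglongrightarrow> 0"
  shows "whp p Q"
  unfolding whp_def prob_random_graph
proof (rule tendsto_sandwich)
  show "\<forall>\<^sub>F n in sequentially. 1 - err n \<le> measure_pmf.prob (graph_pmf n (p n)) {f. Q n (edges_of n f)}"
    using assms(1)
  proof eventually_elim
    case (elim n)
    have "measure_pmf.prob (graph_pmf n (p n)) {f. \<not> Q n (edges_of n f)} =
        1 - measure_pmf.prob (graph_pmf n (p n)) {f. Q n (edges_of n f)}"
      by (subst measure_pmf.prob_compl[symmetric])
        (auto intro!: arg_cong[where f = "measure_pmf.prob (graph_pmf n (p n))"])
    then show ?case using elim by simp
  qed
  show "(\<lambda>n. 1 - err n) \<longlonglongrightarrow> 1" using tendsto_diff[OF tendsto_const assms(2), of 1] by simp
qed auto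

lemma root_powr_power: "x > 0 \<Longrightarrow> k > 0 \<Longrightarrow> (x powr (1 / real k)) ^ k = x"
  by (simp add: powr_power)

lemma whp_tc_le:
  fixes C :: real
  assumes r: "r > 0" and kc: "kc r t = enat k"
    and C: "C = 24 * real ((2 * 4 ^ r) ^ r * 4 ^ r) * real (k + 1)"
    and p: "\<And>n. 0 \<le> p n \<and> p n \<le> 1"
    and large: "\<forall>\<^sub>F n in sequentially. p n > C * (ln (real n) / real n) powr (1 / real (k + 1))"
  shows "whp p (\<lambda>n E. tc r {..<n} E \<le> t)"
proof (rule whpI)
  \<comment> \<open>Needed for \<open>C \<le> C ^ (k + 1)\<close>, so that the bound on
    \<open>p n\<close> can be raised to the power \<open>k + 1\<close> while keeping the factor
    \<open>C\<close>.\<close>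
  have C1: "C \<ge> 1"
  proof -
    have "0 < (2 * 4 ^ r) ^ r * (4 :: nat) ^ r" by (intro mult_pos_pos zero_less_power) auto
    then have "1 * 1 \<le> ((2 * 4 ^ r) ^ r * (4 :: nat) ^ r) * (k + 1)" by (intro mult_le_mono) auto
    then have "real 1 \<le> real (((2 * 4 ^ r) ^ r * 4 ^ r) * (k + 1))"
      by (subst of_nat_le_iff) (simp only: mult_1)
    then show ?thesis unfolding C by (simp only: of_nat_mult)
  qed
  show "\<forall>\<^sub>F n in sequentially.
      measure_pmf.prob (graph_pmf n (p n)) {f. \<not> tc r {..<n} (edges_of n f) \<le> t} \<le> 2 / real n"
    using large eventually_ge_at_top[of "2 * k"] eventually_ge_at_top[of 2]
  proof eventually_elim
    case (elim n)
    let ?x = "ln (real n) / real n"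
    have x: "?x > 0" using elim by simp
    have "C * ?x \<le> C ^ (k + 1) * ?x"
      using C1 x self_le_power[of C "k + 1"] by (intro mult_right_mono) auto
    also have "\<dots> = (C * ?x powr (1 / real (k + 1))) ^ (k + 1)"
      unfolding power_mult_distrib using root_powr_power[OF x, of "k + 1"] by simp
    also have "\<dots> \<le> p n ^ (k + 1)" using elim C1 by (intro power_mono) auto
    finally have "C * ln (real n) \<le> p n ^ (k + 1) * real n"
      using elim by (simp add: field_simps)
    then show ?case
      unfolding C using r p elim kc_eq_enatD(2)[OF kc] by (intro prob_tc_gt_le[where k = k]) auto
  qed
  show "(\<lambda>n. 2 / real n) \<longlonglongrightarrow> 0" by real_asymp
qed

text \<open>With \<open>a = 1 / k\<close> and about \<open>n powr (a / 4)\<close> blocks, the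
  expected number of edges inside them is of order \<open>n powr (a / 2)\<close> times
  \<open>(ln n / n) powr a\<close>, which tends to 0. A block is good with probability at least
  \<open>n powr (- (a / 8))\<close>, so the expected number of good blocks grows at least like
  \<open>n powr (a / 8)\<close>.\<close>

lemma whp_tc_gt:
  fixes c :: real
  assumes r: "r > 0" and k: "k > 0" and part: "partite_hypergraph r V H" and cov: "intersecting_covers (k - 1) H"
    and cn: "cover_number V H > t"
    and c: "c = 1 / (16 * real k * 2 ^ card H)"
    and p: "\<And>n. 0 \<le> p n \<and> p n \<le> 1"
    and small: "\<forall>\<^sub>F n in sequentially. p n < c * (ln (real n) / real n) powr (1 / real k)"
  shows "whp p (\<lambda>n E. tc r {..<n} E > t)"
proof -
  define a where "a = 1 / real k"
  define M where "M = card H"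
  define l where "l n = nat \<lfloor>real n powr (a / 4)\<rfloor>" for n :: nat
  define err1 where "err1 n = (real M)\<^sup>2 * ((real n powr (a / 4))\<^sup>2 * (ln (real n) / real n) powr a)" for n :: nat
  define err2 where "err2 n = exp (- (real n powr (- (a / 8)) * (real n powr (a / 4) - 1)))" for n :: nat
  have a: "a > 0" "a \<le> 1" unfolding a_def using k by auto
  have c1: "c > 0" "c \<le> 1"
  proof -
    have "1 * 1 * 1 \<le> 16 * real k * 2 ^ card H" using k by (intro mult_mono) auto
    then show "c \<le> 1" unfolding c by (simp add: divide_le_eq)
    show "c > 0" unfolding c using k by simp
  qed
  \<comment> \<open>The constant \<open>c\<close> is chosen for this: together with
    \<open>c ^ k \<le> c\<close> it gives \<open>y \<le> a / 16 * ln n / n\<close> below.\<close>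
  have cM: "2 ^ M * c = a / 16" unfolding c a_def M_def by simp
  have "finite V" and sub: "\<And>e. e \<in> H \<Longrightarrow> e \<subseteq> V"
    using part unfolding partite_hypergraph_def uniform_hypergraph_def by auto
  then have finH: "finite H" by (meson PowI finite_Pow_iff finite_subset subsetI)
  have H: "H \<noteq> {}"
  proof
    assume "H = {}"
    then show False using cn cover_number_le[of "{}" V H] by (simp add: edge_cover_def)
  qed
  then have "M > 0" unfolding M_def using finH by (simp add: card_gt_0_iff)
  have lM: "\<forall>\<^sub>F n in sequentially. real n powr (a / 4) * real M \<le> real n"
    using a \<open>M > 0\<close> by real_asymp
  show ?thesis
  proof (rule whpI)
    show "\<forall>\<^sub>F n in sequentially.
        measure_pmf.prob (graph_pmf n (p n)) {f. \<not> tc r {..<n} (edges_of n f) > t} \<le> err1 n + err2 n"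
      using small lM eventually_ge_at_top[of 2]
    proof eventually_elim
      case (elim n)
      let ?x = "ln (real n) / real n"
      define y where "y = 2 ^ M * p n ^ k"
      have x: "?x > 0" "?x \<le> 1" using elim ln_le_minus_one[of "real n"] by auto
      have "p n ^ k \<le> (c * ?x powr (1 / real k)) ^ k" using elim p by (intro power_mono) auto
      also have "\<dots> = c ^ k * ?x" using root_powr_power[OF x(1) k] by (simp only: power_mult_distrib)
      also have "\<dots> \<le> c ^ 1 * ?x" using c1 x k by (intro mult_right_mono power_decreasing) auto
      finally have "2 ^ M * p n ^ k \<le> 2 ^ M * (c * ?x)" by (intro mult_left_mono) auto
      then have yx: "y \<le> a / 16 * ?x" unfolding y_def using cM by (simp only: mult.assoc[symmetric])
      also have "\<dots> \<le> 1 / 16 * 1" using a x by (intro mult_mono) auto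
      finally have y: "y \<le> 1 / 2" by simp
      have y0: "0 \<le> y" unfolding y_def using p by simp
      have "l n * M \<le> n"
      proof -
        have "real (l n) \<le> real n powr (a / 4)" unfolding l_def by simp
        then have "real (l n) * real M \<le> real n powr (a / 4) * real M" by (intro mult_right_mono) auto
        also have "\<dots> \<le> real n" by (rule elim)
        finally have "real (l n * M) \<le> real n" by simp
        then show ?thesis by (simp only: of_nat_le_iff)
      qed
      then have "measure_pmf.prob (graph_pmf n (p n)) {f. \<not> tc r {..<n} (edges_of n f) > t} \<le>
          (real (l n * M))\<^sup>2 * p n + (1 - (1 - y) ^ n) ^ l n"
        unfolding M_def y_def using p y unfolding M_def y_def
        by (intro prob_tc_le_le[OF r part cov cn k H finH]) auto
      also have "\<dots> \<le> err1 n + err2 n"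
      proof (rule add_mono)
        have "(real (l n * M))\<^sup>2 \<le> (real M * real n powr (a / 4))\<^sup>2"
        proof (rule power_mono)
          have "real (l n) \<le> real n powr (a / 4)" unfolding l_def by simp
          then have "real M * real (l n) \<le> real M * real n powr (a / 4)" by (intro mult_left_mono) auto
          then show "real (l n * M) \<le> real M * real n powr (a / 4)" by (simp add: mult.commute)
        qed simp
        moreover have "p n \<le> 1 * ?x powr a"
          using elim(1) c1 unfolding a_def[symmetric]
          by (meson less_imp_le mult_right_mono order_trans powr_ge_zero)
        ultimately have "(real (l n * M))\<^sup>2 * p n \<le> (real M * real n powr (a / 4))\<^sup>2 * (1 * ?x powr a)"
          using p by (intro mult_mono) auto
        then show "(real (l n * M))\<^sup>2 * p n \<le> err1 n"
          unfolding err1_def by (simp only: power_mult_distrib mult_1 mult.assoc)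
        have "- (a / 8 * ln (real n)) \<le> real n * (- 2 * y)"
          using mult_left_mono[OF yx, of "2 * real n"] elim by simp
        also have "\<dots> \<le> real n * ln (1 - y)"
        proof (rule mult_left_mono)
          \<comment> \<open>The bound \<open>- y - 2 * y * y\<close> for \<open>ln (1 - y)\<close>
            is at least \<open>- 2 * y\<close> when \<open>y\<close> is at most one half.\<close>
          have "y * y \<le> y * (1 / 2)" using y y0 by (intro mult_left_mono)
          then show "- 2 * y \<le> ln (1 - y)"
            using ln_one_minus_pos_lower_bound[OF y0 y] by (simp add: power2_eq_square)
        qed simp
        finally have "exp (- (a / 8 * ln (real n))) \<le> exp (real n * ln (1 - y))" by simp
        also have "\<dots> = (1 - y) ^ n" using y by (simp add: exp_of_nat_mult)
        also have "exp (- (a / 8 * ln (real n))) = real n powr (- (a / 8))"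
          using elim by (simp add: powr_def)
        finally have q: "real n powr (- (a / 8)) \<le> (1 - y) ^ n" .
        have "(1 - (1 - y) ^ n) ^ l n \<le> exp (- (real n powr (- (a / 8)))) ^ l n"
        proof (rule power_mono)
          show "1 - (1 - y) ^ n \<le> exp (- (real n powr (- (a / 8))))"
            using exp_ge_add_one_self[of "- (real n powr (- (a / 8)))"] q by linarith
          show "0 \<le> 1 - (1 - y) ^ n" using y y0 by (simp add: power_le_one)
        qed
        also have "\<dots> = exp (real (l n) * - (real n powr (- (a / 8))))" by (simp only: exp_of_nat_mult)
        also have "\<dots> \<le> err2 n"
        proof -
          have "real n powr (a / 4) - 1 \<le> real (l n)" unfolding l_def by linarith
          then have "real n powr (- (a / 8)) * (real n powr (a / 4) - 1) \<le> real n powr (- (a / 8)) * real (l n)"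
            by (intro mult_left_mono) auto
          then show ?thesis unfolding err2_def by (simp add: mult.commute)
        qed
        finally show "(1 - (1 - y) ^ n) ^ l n \<le> err2 n" .
      qed
      finally show ?case .
    qed
    have "(\<lambda>n::nat. (real n powr (a / 4))\<^sup>2 * (ln (real n) / real n) powr a) \<longlonglongrightarrow> 0"
      using a(1) by real_asymp
    then have "err1 \<longlonglongrightarrow> 0" unfolding err1_def by (rule tendsto_mult_right_zero)
    moreover have "err2 \<longlonglongrightarrow> 0" unfolding err2_def using a(1) by real_asymp
    ultimately show "(\<lambda>n. err1 n + err2 n) \<longlonglongrightarrow> 0" using tendsto_add_zero by blast
  qed
qed

theorem theorem1p3:
  fixes r t k :: nat
  assumes "r > 0" and "t > 0" and "kc r t = enat k"
  shows "\<exists>C c :: real. C > 0 \<and> c > 0 \<and>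
    (\<forall>p :: nat \<Rightarrow> real. (\<forall>n. 0 \<le> p n \<and> p n \<le> 1) \<longrightarrow>
      ((\<forall>\<^sub>F n in sequentially. p n < c * (ln (real n) / real n) powr (1 / real k)) \<longrightarrow>
         whp p (\<lambda>n E. tc r {..<n} E > t)) \<and>
      ((\<forall>\<^sub>F n in sequentially. p n > C * (ln (real n) / real n) powr (1 / real (k + 1))) \<longrightarrow>
         whp p (\<lambda>n E. tc r {..<n} E \<le> t)))"
proof -
  have k: "k > 0" using kc_eq_enatD(1)[OF assms(3)] .
  \<comment> \<open>Minimality of \<open>k\<close> yields \<open>H\<close> from the tuple length
    \<open>k - 1\<close> when this is positive; disjoint edges replace it for
    \<open>k = 1\<close>.\<close>
  have "\<exists>(V :: nat set) H. partite_hypergraph r V H \<and> intersecting_covers (k - 1) H \<and> cover_number V H > t"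
  proof (cases "k = 1")
    case True
    then show ?thesis using ex_disjoint_edges[OF assms(1), of t] by simp
  next
    case False
    then show ?thesis using k kc_eq_enatD(3)[OF assms(3), of "k - 1"] by simp
  qed
  then obtain V :: "nat set" and H where H: "partite_hypergraph r V H"
    "intersecting_covers (k - 1) H" "cover_number V H > t" by blast
  \<comment> \<open>Both constants are fixed before \<open>p\<close>: \<open>C\<close> depends on
    \<open>r\<close> and \<open>k\<close>, and \<open>c\<close> on \<open>k\<close> and the chosen
    \<open>H\<close>.\<close>
  define C where "C = 24 * real ((2 * 4 ^ r) ^ r * 4 ^ r) * real (k + 1)"
  define c where "c = 1 / (16 * real k * 2 ^ card H)"
  have "C > 0" unfolding C_def by (intro mult_pos_pos) auto
  moreover have "c > 0" unfolding c_def using k by simp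
  moreover have "whp p (\<lambda>n E. tc r {..<n} E > t)"
    if "\<forall>n. 0 \<le> p n \<and> p n \<le> 1"
      "\<forall>\<^sub>F n in sequentially. p n < c * (ln (real n) / real n) powr (1 / real k)" for p
    using that(1) by (intro whp_tc_gt[OF assms(1) k H c_def _ that(2)]) auto
  moreover have "whp p (\<lambda>n E. tc r {..<n} E \<le> t)"
    if "\<forall>n. 0 \<le> p n \<and> p n \<le> 1"
      "\<forall>\<^sub>F n in sequentially. p n > C * (ln (real n) / real n) powr (1 / real (k + 1))" for p
    using that(1) by (intro whp_tc_le[OF assms(1,3) C_def _ that(2)]) auto
  ultimately show ?thesis by (intro exI[of _ C] exI[of _ c]) simp
qed

end
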